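(* Let $\Phi$ be a real-valued, mean-square continuous, stationary Gaussian process whose covariance has a spectral density $p:\mathbb{R}\to(0,\infty)$, i.e. $\mathrm{Cov}(\Phi(t),\Phi(0))=\int_{\mathbb{R}}e^{it\lambda}p(\lambda)\,d\lambda$, and let $W_\Phi$ and $S_\Phi$ be its analytic wavelet transform and scalogram with respect to an analytic mother wavelet $\psi$. (a) For any $t\in\mathbb{R}$, $d\in\mathbb{N}$ and $s_1,\ldots,s_d>0$, the complex Gaussian random vector $\mathbf{W}=[W_\Phi(t,s_1)\ \cdots\ W_\Phi(t,s_d)]^\top$ is circularly symmetric, i.e. $e^{i\theta}\mathbf{W}$ has the same probability distribution as $\mathbf{W}$ for any $\theta\in\mathbb{R}$. (b) For any $t\in\mathbb{R}$ and $s_1,s_2>0$ with $s_1\ne s_2$, $$\frac{|W_\Phi(t,s_1)-W_\Phi(t,s_2)|^2}{d_{W_\Phi}^2(s_1,s_2)}$$ follows an exponential distribution with mean one, where $d_{W_\Phi}(s_1,s_2)=\left\{\mathbb{E}\left[|W_\Phi(0,s_1)-W_\Phi(0,s_2)|^2\right]\right\}^{1/2}$. (c) For any $t\in\mathbb{R}$ and $s_1,s_2>0$, $$\mathrm{Cov}\left(S_\Phi(t,s_1),S_\Phi(t,s_2)\right)=4\left\{\mathbb{E}\left[W_\Phi^R(t,s_1)W_\Phi^R(t,s_2)\right]\right\}^2+4\left\{\mathbb{E}\left[W_\Phi^R(t,s_1)W_\Phi^I(t,s_2)\right]\right\}^2,$$ where $W_\Phi^R$ and $W_\Phi^I$ are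 the real and imaginary parts of $W_\Phi$. In particular, for any $s>0$, $$\mathrm{Var}\left(S_\Phi(t,s)\right)=4\left\{\mathbb{E}\left[|W_\Phi^R(t,s)|^2\right]\right\}^2=\left\{\mathbb{E}\left[S_\Phi(t,s)\right]\right\}^2.$$
   Context: The mother wavelet $\psi\in L^1(\mathbb{R})\cap L^2(\mathbb{R})$ is complex-valued, nonzero and analytic: its Fourier transform $\widehat\psi(\omega)=\int_{\mathbb{R}}e^{-it\omega}\psi(t)\,dt$ satisfies $\widehat\psi(\omega)=0$ for $\omega\le0$. The analytic wavelet transform of $\Phi$ is $W_\Phi(t,s)=\int_{\mathbb{R}}\Phi(\tau)\frac1s\overline{\psi\left(\frac{\tau-t}{s}\right)}d\tau$, $t\in\mathbb{R}$, $s>0$, and its scalogram is $S_\Phi(t,s)=|W_\Phi(t,s)|^2$. One has the representation $W_\Phi(t,s)=\int_0^\infty e^{it\lambda}\overline{\widehat\psi(s\lambda)}\sqrt{p(\lambda)}\,Z(d\lambda)$, where $\Phi(t)=\mathbb{E}[\Phi(0)]+\int_{\mathbb{R}}e^{it\lambda}\sqrt{p(\lambda)}Z(d\lambda)$ and $Z$ is an orthogonally scattered complex Gaussian random measure on $\mathbb{R}$ with $Z(\Delta)=\overline{Z(-\Delta)}$, $\mathbb{E}[Z(\Delta)]=0$, $\mathbb{E}[Z(\Delta_1)\overline{Z(\Delta_2)}]=\mathrm{Leb}(\Delta_1\cap\Delta_2)$ for Borel sets. *)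

theory Defs
  imports "HOL-Probability.Probability"
begin

text \<open>As usual, a Gaussian variable may be degenerate (almost surely constant).\<close>

definition gaussian_rv :: "'a measure \<Rightarrow> ('a \<Rightarrow> real) \<Rightarrow> bool" where
  "gaussian_rv M X \<longleftrightarrow> X \<in> borel_measurable M \<and>
     ((\<exists>\<mu>. AE x in M. X x = \<mu>) \<or>
      (\<exists>\<mu> \<sigma>. 0 < \<sigma> \<and> distributed M lborel X (normal_density \<mu> \<sigma>)))"

definition gaussian_process :: "'a measure \<Rightarrow> (real \<Rightarrow> 'a \<Rightarrow> real) \<Rightarrow> bool" where
  "gaussian_process M \<Phi> \<longleftrightarrow>
     (\<forall>F a. finite F \<longrightarrow> gaussian_rv M (\<lambda>x. \<Sum>t\<in>F. a t * \<Phi> t x))"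

text \<open>A complex vector is Gaussian if its real and imaginary parts are jointly Gaussian.\<close>

definition complex_gaussian_vector :: "'a measure \<Rightarrow> 'i set \<Rightarrow> ('i \<Rightarrow> 'a \<Rightarrow> complex) \<Rightarrow> bool" where
  "complex_gaussian_vector M I X \<longleftrightarrow>
     (\<forall>a b. gaussian_rv M (\<lambda>x. \<Sum>i\<in>I. a i * Re (X i x) + b i * Im (X i x)))"

definition circularly_symmetric :: "'a measure \<Rightarrow> 'i set \<Rightarrow> ('i \<Rightarrow> 'a \<Rightarrow> complex) \<Rightarrow> bool" where
  "circularly_symmetric M I X \<longleftrightarrow>
     (\<forall>\<theta>::real. distr M (\<Pi>\<^sub>M i\<in>I. borel) (\<lambda>x. \<lambda>i\<in>I. exp (\<i> * of_real \<theta>) * X i x)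
              = distr M (\<Pi>\<^sub>M i\<in>I. borel) (\<lambda>x. \<lambda>i\<in>I. X i x))"

definition covariance :: "'a measure \<Rightarrow> ('a \<Rightarrow> real) \<Rightarrow> ('a \<Rightarrow> real) \<Rightarrow> real" where
  "covariance M X Y =
     (\<integral>x. (X x - (\<integral>y. X y \<partial>M)) * (Y x - (\<integral>y. Y y \<partial>M)) \<partial>M)"

definition stationary_process :: "'a measure \<Rightarrow> (real \<Rightarrow> 'a \<Rightarrow> real) \<Rightarrow> bool" where
  "stationary_process M \<Phi> \<longleftrightarrow>
     (\<forall>F h. finite F \<longrightarrow>
        distr M (\<Pi>\<^sub>M t\<in>F. borel) (\<lambda>x. \<lambda>t\<in>F. \<Phi> (t + h) x)
      = distr M (\<Pi>\<^sub>M t\<in>F. borel) (\<lambda>x. \<lambda>t\<in>F. \<Phi> t x))"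

definition mean_square_continuous :: "'a measure \<Rightarrow> (real \<Rightarrow> 'a \<Rightarrow> real) \<Rightarrow> bool" where
  "mean_square_continuous M \<Phi> \<longleftrightarrow>
     (\<forall>t. ((\<lambda>u. \<integral>x. (\<Phi> u x - \<Phi> t x)\<^sup>2 \<partial>M) \<longlongrightarrow> 0) (at t))"

definition spectral_density :: "'a measure \<Rightarrow> (real \<Rightarrow> 'a \<Rightarrow> real) \<Rightarrow> (real \<Rightarrow> real) \<Rightarrow> bool" where
  "spectral_density M \<Phi> p \<longleftrightarrow>
     (\<forall>\<nu>. 0 < p \<nu>) \<and> integrable lborel p \<and>
     (\<forall>t. complex_of_real (covariance M (\<Phi> t) (\<Phi> 0))
          = (\<integral>\<nu>. exp (\<i> * of_real (t * \<nu>)) * of_real (p \<nu>) \<partial>lborel))"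

definition fourier :: "(real \<Rightarrow> complex) \<Rightarrow> real \<Rightarrow> complex" where
  "fourier \<psi> \<omega> = (\<integral>t. exp (- \<i> * of_real (t * \<omega>)) * \<psi> t \<partial>lborel)"

definition analytic_mother_wavelet :: "(real \<Rightarrow> complex) \<Rightarrow> bool" where
  "analytic_mother_wavelet \<psi> \<longleftrightarrow>
     integrable lborel \<psi> \<and> integrable lborel (\<lambda>t. (cmod (\<psi> t))\<^sup>2) \<and>
     \<not> (AE t in lborel. \<psi> t = 0) \<and>
     (\<forall>\<omega>\<le>0. fourier \<psi> \<omega> = 0)"

definition path_wavelet_transform :: "(real \<Rightarrow> complex) \<Rightarrow> (real \<Rightarrow> real) \<Rightarrow> real \<Rightarrow> real \<Rightarrow> complex" where
  "path_wavelet_transform \<psi> f t s =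
     (\<integral>\<tau>. of_real (f \<tau>) * (1 / of_real s) * cnj (\<psi> ((\<tau> - t) / s)) \<partial>lborel)"

text \<open>The paths of a mean-square continuous process need not be measurable, so the integral is
  taken over a jointly measurable modification of the process.  Two such modifications
  have almost surely the same transform at each \<open>(t, s)\<close>; hence \<open>W\<close> is determined up to
  modification. Existence is shown at the end of this theory.\<close>

definition measurable_modification ::
    "'a measure \<Rightarrow> (real \<Rightarrow> 'a \<Rightarrow> real) \<Rightarrow> (real \<Rightarrow> 'a \<Rightarrow> real) \<Rightarrow> bool" where
  "measurable_modification M \<Phi> \<Phi>' \<longleftrightarrow>
     (\<lambda>(t, x). \<Phi>' t x) \<in> borel_measurable (borel \<Otimes>\<^sub>M M) \<and> (\<forall>t. AE x in M. \<Phi>' t x = \<Phi> t x)"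

definition wavelet_transform_of ::
    "'a measure \<Rightarrow> (real \<Rightarrow> complex) \<Rightarrow> (real \<Rightarrow> 'a \<Rightarrow> real) \<Rightarrow> (real \<Rightarrow> real \<Rightarrow> 'a \<Rightarrow> complex) \<Rightarrow> bool" where
  "wavelet_transform_of M \<psi> \<Phi> W \<longleftrightarrow>
     (\<exists>\<Phi>'. measurable_modification M \<Phi> \<Phi>' \<and>
       (\<forall>t s. 0 < s \<longrightarrow> W t s \<in> borel_measurable M \<and>
          (AE x in M. W t s x = path_wavelet_transform \<psi> (\<lambda>\<tau>. \<Phi>' \<tau> x) t s)))"

definition scalogram :: "(real \<Rightarrow> real \<Rightarrow> 'a \<Rightarrow> complex) \<Rightarrow> real \<Rightarrow> real \<Rightarrow> 'a \<Rightarrow> real" where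
  "scalogram W t s x = (cmod (W t s x))\<^sup>2"

definition wavelet_dist :: "'a measure \<Rightarrow> (real \<Rightarrow> real \<Rightarrow> 'a \<Rightarrow> complex) \<Rightarrow> real \<Rightarrow> real \<Rightarrow> real" where
  "wavelet_dist M W s1 s2 = sqrt (\<integral>x. (cmod (W 0 s1 x - W 0 s2 x))\<^sup>2 \<partial>M)"

lemma (in prob_space) gaussian_rv_square_integrable:
  assumes "gaussian_rv M X"
  shows "integrable M (\<lambda>x. (X x)\<^sup>2)"
proof -
  have X[measurable]: "X \<in> borel_measurable M"
    using assms by (simp add: gaussian_rv_def)
  consider \<mu> where "AE x in M. X x = \<mu>"
    | \<mu> \<sigma> where "0 < \<sigma>" "distributed M lborel X (normal_density \<mu> \<sigma>)"
    using assms unfolding gaussian_rv_def by blast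
  then show ?thesis
  proof cases
    case (1 \<mu>)
    have "integrable M (\<lambda>x. \<mu>\<^sup>2)" by simp
    moreover have "AE x in M. (X x)\<^sup>2 = \<mu>\<^sup>2" using 1 by auto
    ultimately show ?thesis
      by (subst integrable_cong_AE) auto
  next
    case (2 \<mu> \<sigma>)
    have "integrable lborel (\<lambda>x. normal_density \<mu> \<sigma> x * (x - \<mu>) ^ 2
            + 2 * \<mu> * (normal_density \<mu> \<sigma> x * (x - \<mu>) ^ 1) + \<mu>\<^sup>2 * normal_density \<mu> \<sigma> x)"
      using 2(1) by (intro Bochner_Integration.integrable_add integrable_mult_right
          integrable_normal_moment integrable_normal_density)
    also have "(\<lambda>x. normal_density \<mu> \<sigma> x * (x - \<mu>) ^ 2
            + 2 * \<mu> * (normal_density \<mu> \<sigma> x * (x - \<mu>) ^ 1) + \<mu>\<^sup>2 * normal_density \<mu> \<sigma> x)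
          = (\<lambda>x. normal_density \<mu> \<sigma> x * x\<^sup>2)"
      by (auto simp: fun_eq_iff power2_eq_square algebra_simps)
    finally show ?thesis
      using distributed_integrable[OF 2(2), of "\<lambda>x. x\<^sup>2"] by simp
  qed
qed

lemma gaussian_process_measurable:
  assumes "gaussian_process M \<Phi>"
  shows "\<Phi> t \<in> borel_measurable M"
proof -
  have "gaussian_rv M (\<lambda>x. \<Sum>u\<in>{t}. 1 * \<Phi> u x)"
    using assms[unfolded gaussian_process_def, rule_format, of "{t}" "\<lambda>_. 1"] by simp
  then show ?thesis by (simp add: gaussian_rv_def)
qed

lemma (in prob_space) gaussian_process_increment_square_integrable:
  assumes "gaussian_process M \<Phi>"
  shows "integrable M (\<lambda>x. (\<Phi> u x - \<Phi> t x)\<^sup>2)"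
proof (cases "u = t")
  case False
  have "gaussian_rv M (\<lambda>x. \<Sum>v\<in>{u, t}. (if v = u then 1 else -1) * \<Phi> v x)"
    using assms[unfolded gaussian_process_def, rule_format, of "{u, t}" "\<lambda>v. if v = u then 1 else -1"]
    by simp
  also have "(\<lambda>x. \<Sum>v\<in>{u, t}. (if v = u then 1 else -1) * \<Phi> v x) = (\<lambda>x. \<Phi> u x - \<Phi> t x)"
    using False by (auto simp: fun_eq_iff)
  finally show ?thesis by (rule gaussian_rv_square_integrable)
qed simp

lemma (in prob_space) stationary_increment:
  assumes "stationary_process M \<Phi>" and [measurable]: "\<And>t. \<Phi> t \<in> borel_measurable M"
  shows "(\<integral>x. (\<Phi> u x - \<Phi> t x)\<^sup>2 \<partial>M) = (\<integral>x. (\<Phi> (u - t) x - \<Phi> 0 x)\<^sup>2 \<partial>M)"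
proof -
  let ?F = "{u - t, 0}"
  let ?P = "\<Pi>\<^sub>M t\<in>?F. (borel :: real measure)"
  let ?g = "\<lambda>\<phi>::real \<Rightarrow> real. (\<phi> (u - t) - \<phi> 0)\<^sup>2"
  have g[measurable]: "?g \<in> borel_measurable ?P"
    by (intro borel_measurable_power borel_measurable_diff measurable_component_singleton) auto
  have eq: "distr M ?P (\<lambda>x. \<lambda>v\<in>?F. \<Phi> (v + t) x) = distr M ?P (\<lambda>x. \<lambda>v\<in>?F. \<Phi> v x)"
    using assms(1)[unfolded stationary_process_def, rule_format, of ?F t] by blast
  have "(\<integral>x. (\<Phi> u x - \<Phi> t x)\<^sup>2 \<partial>M) = (\<integral>x. ?g (\<lambda>v\<in>?F. \<Phi> (v + t) x) \<partial>M)"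
    by simp
  also have "\<dots> = (\<integral>\<phi>. ?g \<phi> \<partial>distr M ?P (\<lambda>x. \<lambda>v\<in>?F. \<Phi> (v + t) x))"
    by (intro integral_distr[symmetric] g measurable_restrict) auto
  also have "\<dots> = (\<integral>\<phi>. ?g \<phi> \<partial>distr M ?P (\<lambda>x. \<lambda>v\<in>?F. \<Phi> v x))"
    by (simp only: eq)
  also have "\<dots> = (\<integral>x. ?g (\<lambda>v\<in>?F. \<Phi> v x) \<partial>M)"
    by (intro integral_distr g measurable_restrict) auto
  finally show ?thesis by simp
qed

lemma (in prob_space) measurable_modification_exists:
  assumes gauss: "gaussian_process M \<Phi>" and stat: "stationary_process M \<Phi>"
    and cont: "mean_square_continuous M \<Phi>"
  shows "\<exists>\<Phi>'. measurable_modification M \<Phi> \<Phi>'"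
proof -
  have meas[measurable]: "\<Phi> t \<in> borel_measurable M" for t
    using gauss by (rule gaussian_process_measurable)
  let ?D = "\<lambda>h. \<integral>x. (\<Phi> h x - \<Phi> 0 x)\<^sup>2 \<partial>M"
  have "\<exists>\<delta>>0. \<forall>h. \<bar>h\<bar> < \<delta> \<longrightarrow> ?D h < (1/2) ^ n" for n :: nat
  proof -
    have "\<forall>\<^sub>F h in at 0. ?D h < (1/2) ^ n"
      using cont unfolding mean_square_continuous_def by (rule_tac order_tendstoD(2)) auto
    then obtain d where "d > 0" and d: "\<And>h. h \<noteq> 0 \<Longrightarrow> dist h 0 < d \<Longrightarrow> ?D h < (1/2) ^ n"
      unfolding eventually_at by auto
    have "?D h < (1/2) ^ n" if "\<bar>h\<bar> < d" for h
      using d[of h] that by (cases "h = 0") auto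
    then show ?thesis using \<open>d > 0\<close> by blast
  qed
  then obtain \<delta> where \<delta>: "\<And>n. \<delta> n > 0" "\<And>n h. \<bar>h\<bar> < \<delta> n \<Longrightarrow> ?D h < (1/2) ^ n"
    by metis
  define q where "q n t = \<delta> n * real_of_int \<lfloor>t / \<delta> n\<rfloor>" for n t
  define \<Phi>' where "\<Phi>' t x = lim (\<lambda>n. \<Phi> (q n t) x)" for t x
  have q: "\<bar>q n t - t\<bar> < \<delta> n" for n t
  proof -
    have "q n t \<le> t" "t < q n t + \<delta> n"
      using floor_divide_lower[OF \<delta>(1), of t n] floor_divide_upper[OF \<delta>(1), of t n]
      by (auto simp: q_def algebra_simps)
    then show ?thesis by auto
  qed
  have "(\<lambda>(t, x). \<Phi>' t x) \<in> borel_measurable (borel \<Otimes>\<^sub>M M)"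
  proof -
    have "(\<lambda>z. \<Phi> (\<delta> n * real_of_int \<lfloor>fst z / \<delta> n\<rfloor>) (snd z)) \<in> borel_measurable (borel \<Otimes>\<^sub>M M)" for n
      by (rule measurable_compose_countable[where f="\<lambda>k z. \<Phi> (\<delta> n * real_of_int k) (snd z)"])
         measurable
    then have "(\<lambda>z. lim (\<lambda>n. \<Phi> (q n (fst z)) (snd z))) \<in> borel_measurable (borel \<Otimes>\<^sub>M M)"
      unfolding q_def by (intro borel_measurable_lim_metric)
    then show ?thesis by (simp add: \<Phi>'_def case_prod_beta')
  qed
  moreover have "AE x in M. \<Phi>' t x = \<Phi> t x" for t
  proof -
    let ?X = "\<lambda>n x. (\<Phi> (q n t) x - \<Phi> t x)\<^sup>2"
    have int: "integrable M (?X n)" for n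
      using gauss by (rule gaussian_process_increment_square_integrable)
    have le: "(\<integral>x. ?X n x \<partial>M) \<le> (1/2) ^ n" for n
      using \<delta>(2)[OF q, of n t] stationary_increment[OF stat meas, of "q n t" t] by simp
    have "(\<integral>\<^sup>+x. (\<Sum>n. ennreal (?X n x)) \<partial>M) = (\<Sum>n. \<integral>\<^sup>+x. ennreal (?X n x) \<partial>M)"
      by (intro nn_integral_suminf) measurable
    also have "\<dots> \<le> (\<Sum>n. ennreal ((1/2) ^ n))"
      by (intro suminf_le) (auto simp: nn_integral_eq_integral[OF int] intro!: ennreal_leI le)
    also have "\<dots> < \<infinity>"
      by (subst suminf_ennreal2) (auto intro: summable_geometric)
    finally have "AE x in M. (\<Sum>n. ennreal (?X n x)) \<noteq> \<infinity>"
      by (intro nn_integral_PInf_AE) auto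
    then show ?thesis
    proof eventually_elim
      case (elim x)
      then have "summable (\<lambda>n. ?X n x)"
        by (intro summable_suminf_not_top) auto
      then have "(\<lambda>n. sqrt (?X n x)) \<longlonglongrightarrow> sqrt 0"
        by (intro tendsto_real_sqrt summable_LIMSEQ_zero)
      then have "(\<lambda>n. \<Phi> (q n t) x - \<Phi> t x) \<longlonglongrightarrow> 0"
        by (simp add: tendsto_rabs_zero_iff)
      then have "(\<lambda>n. \<Phi> (q n t) x) \<longlonglongrightarrow> \<Phi> t x"
        by (rule LIM_zero_cancel)
      then show ?case unfolding \<Phi>'_def by (rule limI)
    qed
  qed
  ultimately show ?thesis unfolding measurable_modification_def by blast
qed

lemma (in prob_space) wavelet_transform_exists:
  assumes "gaussian_process M \<Phi>" "stationary_process M \<Phi>" "mean_square_continuous M \<Phi>"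
    and "analytic_mother_wavelet \<psi>"
  shows "\<exists>W. wavelet_transform_of M \<psi> \<Phi> W"
proof -
  obtain \<Phi>' where \<Phi>': "measurable_modification M \<Phi> \<Phi>'"
    using measurable_modification_exists assms by blast
  have [measurable]: "(\<lambda>(t, x). \<Phi>' t x) \<in> borel_measurable (borel \<Otimes>\<^sub>M M)"
    using \<Phi>' by (simp add: measurable_modification_def)
  have [measurable]: "\<psi> \<in> borel_measurable borel"
    using assms(4) by (auto simp: analytic_mother_wavelet_def dest: borel_measurable_integrable)
  have [measurable]: "cnj \<in> borel_measurable borel"
    by (intro borel_measurable_continuous_onI continuous_intros)
  have [measurable]: "(\<lambda>z. \<Phi>' (snd z) (fst z)) \<in> borel_measurable (M \<Otimes>\<^sub>M lborel)"
    by (rule measurable_compose[of "\<lambda>z. (snd z, fst z)" _ "borel \<Otimes>\<^sub>M M" "\<lambda>(t, x). \<Phi>' t x",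
          simplified]) measurable
  have "(\<lambda>x. path_wavelet_transform \<psi> (\<lambda>\<tau>. \<Phi>' \<tau> x) t s) \<in> borel_measurable M" for t s
    unfolding path_wavelet_transform_def
    by (intro lborel.borel_measurable_lebesgue_integral, unfold case_prod_beta') measurable
  then have "wavelet_transform_of M \<psi> \<Phi> (\<lambda>t s x. path_wavelet_transform \<psi> (\<lambda>\<tau>. \<Phi>' \<tau> x) t s)"
    using \<Phi>' unfolding wavelet_transform_of_def by blast
  then show ?thesis by blast
qed

end

theory Submission
  imports Defs
begin

text \<open>Every linear combination of wavelet coefficients at time \<open>t\<close> is almost surely the path integral
  of the process against a complex kernel \<open>G\<close> whose Fourier transform vanishes on
  \<open>[0, \<infinity>)\<close>.  Approximating the process by finitely-valued samplings of the time axis shows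
  that the real part of such an integral is an \<open>L\<^sup>1\<close>-limit of Gaussian variables, hence Gaussian.
  The spectral formula for second moments gives mean \<open>0\<close>, pseudo-covariance \<open>0\<close> and energy
  \<open>\<integral> p(\<nu>) |fourier G (-\<nu>)|\<^sup>2 d\<nu>\<close>, which is unchanged when \<open>G\<close> is multiplied by a phase.  Hence the joint
  characteristic function is invariant under rotations, which is (a).  For (b), the real and imaginary
  parts of the difference are independent and identically distributed centred Gaussian variables; their
  variance is positive since otherwise the Fourier transform of \<open>\<psi>\<close> would be invariant under scaling by
  \<open>s1 / s2\<close>, hence constant by continuity at \<open>0\<close>, hence zero.  Part (c) is Isserlis' formula together
  with the vanishing pseudo-covariance.\<close>

section \<open>Gaussian variables and characteristic functions\<close>

text \<open>No random spectral measure is constructed: the second moments it would supply are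
  computed from the covariance by exchanging integrals. The work is done on kernels rather than on
  random variables. An imaginary part is the real part belonging to the kernel multiplied by -i, and
  a Re w + b Im w = Re ((a - ib) w), so Gaussian laws are needed only for real variables
  \<open>Re (lin G x)\<close>, and joint laws are reached through the characteristic functions of
  such variables. The unknown mean of the process disappears because the Fourier transform of every
  kernel in question vanishes at 0. Two features of the setting shape the argument. And
  \<open>W t s\<close> is determined only up to a null set for each (t, s), so identities between
  coefficients hold almost surely, for finitely many scales at a time.\<close>

lemma (in prob_space) gaussian_rv_char:
  assumes "gaussian_rv M X"
  shows "(\<integral>x. iexp (u * X x) \<partial>M) = exp (\<i> * of_real (u * expectation X) - of_real (u\<^sup>2 * variance X / 2))"
proof -
  have X[measurable]: "X \<in> borel_measurable M"
    using assms by (simp add: gaussian_rv_def)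
  consider \<mu> where "AE x in M. X x = \<mu>"
    | \<mu> \<sigma> where "0 < \<sigma>" "distributed M lborel X (normal_density \<mu> \<sigma>)"
    using assms unfolding gaussian_rv_def by blast
  then show ?thesis
  proof cases
    case (1 \<mu>)
    have "expectation X = (\<integral>x. \<mu> \<partial>M)"
      using 1 by (intro integral_cong_AE) auto
    then have e: "expectation X = \<mu>" by (simp add: prob_space)
    have "variance X = (\<integral>x. 0 \<partial>M)"
      using 1 by (intro integral_cong_AE) (auto simp: e)
    moreover have "(\<integral>x. iexp (u * X x) \<partial>M) = (\<integral>x. iexp (u * \<mu>) \<partial>M)"
      using 1 by (intro integral_cong_AE) auto
    ultimately show ?thesis by (simp add: e prob_space)
  next
    case (2 \<mu> \<sigma>)
    let ?Z = "\<lambda>x. (X x - \<mu>) / \<sigma>"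
    have D: "distributed M lborel ?Z std_normal_density"
      using 2 normal_standard_normal_convert[of \<sigma> X \<mu>] by simp
    have "char std_normal_distribution (u * \<sigma>) = (\<integral>z. iexp (u * \<sigma> * z) \<partial>distr M borel ?Z)"
      using distributed_distr_eq_density[OF D] unfolding char_def
      by (simp add: distr_cong[OF refl sets_lborel])
    also have "\<dots> = (\<integral>x. iexp (u * \<sigma> * ?Z x) \<partial>M)"
      by (subst integral_distr) auto
    finally have Z: "(\<integral>x. iexp (u * \<sigma> * ?Z x) \<partial>M) = of_real (exp (- (u * \<sigma>)\<^sup>2 / 2))"
      by (simp add: char_std_normal_distribution)
    have "iexp (u * X x) = iexp (u * \<mu>) * iexp (u * \<sigma> * ?Z x)" for x
      using 2(1) by (simp add: exp_add[symmetric] field_simps)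
    then have "(\<integral>x. iexp (u * X x) \<partial>M) = iexp (u * \<mu>) * (\<integral>x. iexp (u * \<sigma> * ?Z x) \<partial>M)"
      by simp
    then show ?thesis
      using normal_distributed_expectation[OF 2] normal_distributed_variance[OF 2]
      by (simp only: Z) (simp add: exp_of_real[symmetric] exp_add[symmetric] power_mult_distrib)
  qed
qed

text \<open>The characteristic function determines the law: a point mass for \<open>v = 0\<close>, a
  normal law with deviation \<open>sqrt v\<close> otherwise. This is the criterion for passing to
  almost surely equal variables and to limits, where no density can be followed.\<close>

lemma (in prob_space) gaussian_rvI_char:
  assumes X[measurable]: "X \<in> borel_measurable M" and v: "0 \<le> v"
    and char: "\<And>u. (\<integral>x. iexp (u * X x) \<partial>M) = exp (\<i> * of_real (u * \<mu>) - of_real (u\<^sup>2 * v / 2))"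
  shows "gaussian_rv M X"
proof -
  have chX: "char (distr M borel X) u = exp (\<i> * of_real (u * \<mu>) - of_real (u\<^sup>2 * v / 2))" for u
    unfolding char_def by (subst integral_distr, measurable, rule char)
  have rX: "real_distribution (distr M borel X)"
    by (rule real_distribution_distr) simp
  show ?thesis
  proof (cases "v = 0")
    case True
    interpret D: prob_space "return borel \<mu>" by (rule prob_space_return) simp
    have rr: "real_distribution (return borel \<mu>)"
      by unfold_locales auto
    have "char (return borel \<mu>) u = iexp (u * \<mu>)" for u
      by (simp add: char_def integral_return)
    then have "distr M borel X = return borel \<mu>"
      by (intro Levy_uniqueness[OF rX rr]) (simp add: fun_eq_iff chX True)
    moreover have "AE y in return borel \<mu>. y = \<mu>"
      by (subst AE_return) auto
    ultimately have "AE y in distr M borel X. y = \<mu>"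
      by metis
    then have "AE x in M. X x = \<mu>"
      by (subst (asm) AE_distr_iff) auto
    then show ?thesis by (auto simp: gaussian_rv_def)
  next
    case False
    define \<sigma> where "\<sigma> = sqrt v"
    have \<sigma>: "0 < \<sigma>" "\<sigma>\<^sup>2 = v" using v False by (auto simp: \<sigma>_def)
    let ?N = "density lborel (normal_density \<mu> \<sigma>)"
    interpret N: prob_space ?N by (rule prob_space_normal_density) fact
    have rN: "real_distribution ?N"
      by unfold_locales auto
    have DN: "distributed ?N lborel (\<lambda>x. x) (normal_density \<mu> \<sigma>)"
      by (auto simp: distributed_def distr_id2)
    then have "gaussian_rv ?N (\<lambda>x. x)"
      using \<sigma> by (auto simp: gaussian_rv_def)
    from N.gaussian_rv_char[OF this]
    have "char ?N u = exp (\<i> * of_real (u * \<mu>) - of_real (u\<^sup>2 * v / 2))" for u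
      unfolding char_def
      using N.normal_distributed_expectation[OF \<sigma>(1) DN] N.normal_distributed_variance[OF \<sigma>(1) DN] \<sigma>
      by simp
    then have "distr M borel X = ?N"
      by (intro Levy_uniqueness[OF rX rN]) (auto simp: fun_eq_iff chX)
    then have "distributed M lborel X (normal_density \<mu> \<sigma>)"
      by (auto simp: distributed_def distr_cong[OF refl sets_lborel])
    then show ?thesis using \<sigma> by (auto simp: gaussian_rv_def)
  qed
qed

lemma (in prob_space) gaussian_rv_cong_AE:
  assumes "gaussian_rv M X" "AE x in M. X x = Y x" "Y \<in> borel_measurable M"
  shows "gaussian_rv M Y"
proof -
  have [measurable]: "X \<in> borel_measurable M" "Y \<in> borel_measurable M"
    using assms by (auto simp: gaussian_rv_def)
  have "(\<integral>x. iexp (u * Y x) \<partial>M) = (\<integral>x. iexp (u * X x) \<partial>M)" for u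
    using assms(2) by (intro integral_cong_AE) auto
  with gaussian_rv_char[OF assms(1)] show ?thesis
    by (intro gaussian_rvI_char[where v="variance X" and \<mu>="expectation X"]) auto
qed

text \<open>Convergence in L1 controls means and characteristic functions but says nothing directly
  about variances. These are read off from the modulus exp (- u^2 v / 2) of the characteristic
  function at a single u, and their convergence gives the limit function its Gaussian form.\<close>

lemma (in prob_space) gaussian_rv_L1_limit:
  assumes gauss: "\<And>n. gaussian_rv M (X n)"
    and Y[measurable]: "integrable M Y"
    and lim: "(\<lambda>n. \<integral>x. \<bar>X n x - Y x\<bar> \<partial>M) \<longlonglongrightarrow> 0"
  shows "gaussian_rv M Y"
proof -
  have [measurable]: "X n \<in> borel_measurable M" for n
    using gauss by (auto simp: gaussian_rv_def)
  have int: "integrable M (X n)" for n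
    by (rule square_integrable_imp_integrable[OF _ gaussian_rv_square_integrable[OF gauss]]) simp
  have "(\<lambda>n. expectation (X n) - expectation Y) \<longlonglongrightarrow> 0"
  proof (rule Lim_null_comparison[OF always_eventually lim], rule allI)
    fix n
    have "expectation (X n) - expectation Y = (\<integral>x. X n x - Y x \<partial>M)"
      using int Y by simp
    then show "norm (expectation (X n) - expectation Y) \<le> (\<integral>x. \<bar>X n x - Y x\<bar> \<partial>M)"
      using integral_norm_bound[of M "\<lambda>x. X n x - Y x"] by simp
  qed
  then have mean: "(\<lambda>n. expectation (X n)) \<longlonglongrightarrow> expectation Y"
    by (rule LIM_zero_cancel)
  let ?c = "\<lambda>u n. exp (\<i> * of_real (u * expectation (X n)) - of_real (u\<^sup>2 * variance (X n) / 2))"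
  let ?\<phi> = "\<lambda>u. \<integral>x. iexp (u * Y x) \<partial>M"
  have c: "?c u \<longlonglongrightarrow> ?\<phi> u" for u
  proof (rule LIM_zero_cancel, rule Lim_null_comparison[OF always_eventually], rule allI)
    show "(\<lambda>n. \<bar>u\<bar> * (\<integral>x. \<bar>X n x - Y x\<bar> \<partial>M)) \<longlonglongrightarrow> 0"
      using tendsto_mult_left[OF lim, of "\<bar>u\<bar>"] by simp
    fix n
    have I: "integrable M (\<lambda>x. iexp (u * X n x))" "integrable M (\<lambda>x. iexp (u * Y x))"
      by (auto intro!: integrable_const_bound[where B=1])
    have "?c u n - ?\<phi> u = (\<integral>x. iexp (u * X n x) - iexp (u * Y x) \<partial>M)"
      using I by (simp only: gaussian_rv_char[OF gauss, symmetric] Bochner_Integration.integral_diff)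
    also have "norm \<dots> \<le> (\<integral>x. norm (iexp (u * X n x) - iexp (u * Y x)) \<partial>M)"
      by (rule integral_norm_bound)
    also have "\<dots> \<le> (\<integral>x. \<bar>u\<bar> * \<bar>X n x - Y x\<bar> \<partial>M)"
    proof (rule integral_mono)
      show "integrable M (\<lambda>x. norm (iexp (u * X n x) - iexp (u * Y x)))" using I by auto
      show "integrable M (\<lambda>x. \<bar>u\<bar> * \<bar>X n x - Y x\<bar>)" using int Y by auto
      fix x
      \<comment> \<open>A factor of modulus 1 is split off, so the difference is controlled by |exp
        (i r) - 1| \<le> |r|.\<close>
      have "iexp (u * X n x) - iexp (u * Y x) = iexp (u * Y x) * (iexp (u * (X n x - Y x)) - 1)"
        by (simp add: algebra_simps exp_add[symmetric])
      then have "norm (iexp (u * X n x) - iexp (u * Y x)) = norm (iexp (u * (X n x - Y x)) - 1)"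
        by (simp add: norm_mult)
      also have "\<dots> \<le> \<bar>u * (X n x - Y x)\<bar>"
        using iexp_approx1[of "u * (X n x - Y x)" 0] by simp
      finally show "norm (iexp (u * X n x) - iexp (u * Y x)) \<le> \<bar>u\<bar> * \<bar>X n x - Y x\<bar>"
        by (simp add: abs_mult)
    qed
    finally show "norm (?c u n - ?\<phi> u) \<le> \<bar>u\<bar> * (\<integral>x. \<bar>X n x - Y x\<bar> \<partial>M)"
      by simp
  qed
  interpret D: real_distribution "distr M borel Y" by (rule real_distribution_distr) simp
  have \<phi>: "?\<phi> u = char (distr M borel Y) u" for u
    unfolding char_def by (subst integral_distr) auto
  \<comment> \<open>A nonzero frequency at which the limit does not vanish, so that a logarithm can
    be taken: the limit is a characteristic function, hence continuous with value 1 at 0.\<close>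
  obtain u where u: "u \<noteq> 0" "?\<phi> u \<noteq> 0"
  proof -
    have "(char (distr M borel Y) \<longlongrightarrow> 1) (at 0)"
      using D.isCont_char[of 0] by (simp add: isCont_def D.char_zero)
    then have "\<forall>\<^sub>F u in at 0. char (distr M borel Y) u \<noteq> 0"
      by (rule tendsto_imp_eventually_ne) simp
    then have "\<forall>\<^sub>F u in at 0. u \<noteq> 0 \<and> char (distr M borel Y) u \<noteq> 0"
      by (intro eventually_conj) (auto simp: eventually_at_filter)
    from eventually_happens[OF this] obtain u where "u \<noteq> 0" "char (distr M borel Y) u \<noteq> 0"
      by auto
    then show ?thesis by (intro that[of u]) (simp_all only: \<phi> not_False_eq_True)
  qed
  have "(\<lambda>n. norm (?c u n)) \<longlonglongrightarrow> norm (?\<phi> u)" by (intro tendsto_norm c)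
  then have "(\<lambda>n. exp (- (u\<^sup>2 * variance (X n) / 2))) \<longlonglongrightarrow> norm (?\<phi> u)"
    by (simp add: norm_exp_eq_Re)
  then have "(\<lambda>n. ln (exp (- (u\<^sup>2 * variance (X n) / 2)))) \<longlonglongrightarrow> ln (norm (?\<phi> u))"
    using u by (intro tendsto_ln) auto
  then have "(\<lambda>n. (- 2 / u\<^sup>2) * ln (exp (- (u\<^sup>2 * variance (X n) / 2)))) \<longlonglongrightarrow> (- 2 / u\<^sup>2) * ln (norm (?\<phi> u))"
    by (rule tendsto_mult_left)
  then have var: "(\<lambda>n. variance (X n)) \<longlonglongrightarrow> (- 2 / u\<^sup>2) * ln (norm (?\<phi> u))" (is "_ \<longlonglongrightarrow> ?v")
    using u(1) by simp
  have v: "0 \<le> ?v" by (rule LIMSEQ_le_const[OF var]) auto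
  have "?\<phi> w = exp (\<i> * of_real (w * expectation Y) - of_real (w\<^sup>2 * ?v / 2))" for w
    by (rule LIMSEQ_unique[OF c]) (intro tendsto_intros mean var, simp)
  then show ?thesis
    by (rule gaussian_rvI_char[OF borel_measurable_integrable[OF Y] v])
qed

lemma gaussian_process_gaussian_rv:
  assumes "gaussian_process M \<Phi>"
  shows "gaussian_rv M (\<Phi> t)"
  using assms[unfolded gaussian_process_def, rule_format, of "{t}" "\<lambda>_. 1"] by simp

section \<open>Fourth moments of centred Gaussian variables\<close>

lemma (in prob_space) gaussian_rv_fourth_moment:
  assumes X: "gaussian_rv M X" and mean: "expectation X = 0"
  shows "integrable M (\<lambda>x. X x ^ 4)" and "expectation (\<lambda>x. X x ^ 4) = 3 * (expectation (\<lambda>x. (X x)\<^sup>2))\<^sup>2"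
proof -
  have [measurable]: "X \<in> borel_measurable M"
    using X by (simp add: gaussian_rv_def)
  consider \<mu> where "AE x in M. X x = \<mu>"
    | \<mu> \<sigma> where "0 < \<sigma>" "distributed M lborel X (normal_density \<mu> \<sigma>)"
    using X unfolding gaussian_rv_def by blast
  then have "integrable M (\<lambda>x. X x ^ 4) \<and> expectation (\<lambda>x. X x ^ 4) = 3 * (expectation (\<lambda>x. (X x)\<^sup>2))\<^sup>2"
  proof cases
    case (1 \<mu>)
    have "expectation X = (\<integral>x. \<mu> \<partial>M)"
      using 1 by (intro integral_cong_AE) auto
    then have 0: "AE x in M. X x = 0" using 1 mean by (simp add: prob_space)
    have "expectation (\<lambda>x. (X x)\<^sup>2) = (\<integral>x. 0 \<partial>M)"
      using 0 by (intro integral_cong_AE) auto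
    moreover have "expectation (\<lambda>x. X x ^ 4) = (\<integral>x. 0 \<partial>M)"
      using 0 by (intro integral_cong_AE) auto
    moreover have "integrable M (\<lambda>x. X x ^ 4) = integrable M (\<lambda>x. 0 :: real)"
      using 0 by (intro integrable_cong_AE) auto
    ultimately show ?thesis by simp
  next
    case (2 \<mu> \<sigma>)
    then have \<mu>: "\<mu> = 0" using normal_distributed_expectation[OF 2] mean by simp
    note D = 2(2)[unfolded \<mu>]
    have m4: "(\<integral>x. normal_density 0 \<sigma> x * x ^ 4 \<partial>lborel) = 3 * \<sigma> ^ 4"
      using integral_normal_moment_even[OF 2(1), of 0 2] 2(1) by (simp add: fact_numeral field_simps power2_eq_square power4_eq_xxxx)
    have m2: "(\<integral>x. normal_density 0 \<sigma> x * x\<^sup>2 \<partial>lborel) = \<sigma>\<^sup>2"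
      using integral_normal_moment_even[OF 2(1), of 0 1] 2(1) by (simp add: fact_numeral)
    have "integrable M (\<lambda>x. X x ^ 4)"
      using distributed_integrable[OF D, of "\<lambda>x. x ^ 4"] integrable_normal_moment[OF 2(1), of 0 4] by simp
    moreover have "expectation (\<lambda>x. X x ^ 4) = 3 * \<sigma> ^ 4" "expectation (\<lambda>x. (X x)\<^sup>2) = \<sigma>\<^sup>2"
      using distributed_integral[OF D, of "\<lambda>x. x ^ 4"] distributed_integral[OF D, of "\<lambda>x. x\<^sup>2"] m4 m2 by simp_all
    ultimately show ?thesis by simp
  qed
  then show "integrable M (\<lambda>x. X x ^ 4)" and "expectation (\<lambda>x. X x ^ 4) = 3 * (expectation (\<lambda>x. (X x)\<^sup>2))\<^sup>2"
    by auto
qed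

text \<open>Polarisation replaces the joint density: 12 X^2 Y^2 = (X + Y)^4 + (X - Y)^4 - 2 X^4 - 2
  Y^4, and each fourth power is that of one centred Gaussian variable, with expectation three times
  the squared second moment.\<close>

lemma (in prob_space) isserlis_square:
  assumes X: "gaussian_rv M X" "expectation X = 0" and Y: "gaussian_rv M Y" "expectation Y = 0"
    and add: "gaussian_rv M (\<lambda>x. X x + Y x)" and diff: "gaussian_rv M (\<lambda>x. X x - Y x)"
  shows "integrable M (\<lambda>x. (X x)\<^sup>2 * (Y x)\<^sup>2)"
    and "expectation (\<lambda>x. (X x)\<^sup>2 * (Y x)\<^sup>2)
      = expectation (\<lambda>x. (X x)\<^sup>2) * expectation (\<lambda>x. (Y x)\<^sup>2) + 2 * (expectation (\<lambda>x. X x * Y x))\<^sup>2"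
proof -
  have [measurable]: "X \<in> borel_measurable M" "Y \<in> borel_measurable M"
    using X Y by (auto simp: gaussian_rv_def)
  note sq = gaussian_rv_square_integrable[OF X(1)] gaussian_rv_square_integrable[OF Y(1)]
    gaussian_rv_square_integrable[OF add]
  have int: "integrable M X" "integrable M Y"
    using sq by (auto intro: square_integrable_imp_integrable)
  have "integrable M (\<lambda>x. ((X x + Y x)\<^sup>2 - (X x)\<^sup>2 - (Y x)\<^sup>2) / 2)"
    using sq by simp
  also have "(\<lambda>x. ((X x + Y x)\<^sup>2 - (X x)\<^sup>2 - (Y x)\<^sup>2) / 2) = (\<lambda>x. X x * Y x)"
    by (auto simp: power2_eq_square algebra_simps)
  finally have XY: "integrable M (\<lambda>x. X x * Y x)" .
  let ?a = "expectation (\<lambda>x. (X x)\<^sup>2)" and ?b = "expectation (\<lambda>x. (Y x)\<^sup>2)" and ?c = "expectation (\<lambda>x. X x * Y x)"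
  have mean: "expectation (\<lambda>x. X x + Y x) = 0" "expectation (\<lambda>x. X x - Y x) = 0"
    using int X Y by simp_all
  have p: "expectation (\<lambda>x. (X x + Y x)\<^sup>2) = ?a + 2 * ?c + ?b"
  proof -
    have "(\<lambda>x. (X x + Y x)\<^sup>2) = (\<lambda>x. (X x)\<^sup>2 + 2 * (X x * Y x) + (Y x)\<^sup>2)"
      by (auto simp: power2_eq_square algebra_simps)
    then show ?thesis using sq XY by simp
  qed
  have n: "expectation (\<lambda>x. (X x - Y x)\<^sup>2) = ?a - 2 * ?c + ?b"
  proof -
    have "(\<lambda>x. (X x - Y x)\<^sup>2) = (\<lambda>x. (X x)\<^sup>2 - 2 * (X x * Y x) + (Y x)\<^sup>2)"
      by (auto simp: power2_eq_square algebra_simps)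
    then show ?thesis using sq XY by simp
  qed
  note fX = gaussian_rv_fourth_moment[OF X] and fY = gaussian_rv_fourth_moment[OF Y]
    and fa = gaussian_rv_fourth_moment[OF add mean(1)] and fd = gaussian_rv_fourth_moment[OF diff mean(2)]
  have polar: "(\<lambda>x. (X x)\<^sup>2 * (Y x)\<^sup>2) = (\<lambda>x. ((X x + Y x) ^ 4 + (X x - Y x) ^ 4 - 2 * X x ^ 4 - 2 * Y x ^ 4) / 12)"
    by (auto simp: power2_eq_square power4_eq_xxxx algebra_simps)
  show "integrable M (\<lambda>x. (X x)\<^sup>2 * (Y x)\<^sup>2)"
    unfolding polar using fX fY fa fd by simp
  have "expectation (\<lambda>x. (X x)\<^sup>2 * (Y x)\<^sup>2)
      = (3 * (?a + 2 * ?c + ?b)\<^sup>2 + 3 * (?a - 2 * ?c + ?b)\<^sup>2 - 2 * (3 * ?a\<^sup>2) - 2 * (3 * ?b\<^sup>2)) / 12"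
    unfolding polar using fX fY fa fd p n by simp
  also have "\<dots> = ?a * ?b + 2 * ?c\<^sup>2"
    by (simp add: power2_eq_square algebra_simps)
  finally show "expectation (\<lambda>x. (X x)\<^sup>2 * (Y x)\<^sup>2) = ?a * ?b + 2 * ?c\<^sup>2" .
qed

section \<open>Uniqueness of joint characteristic functions\<close>

text \<open>The value at 0 of the characteristic function is the total mass. Hence both measures can
  be normalised by the same constant and compared as probability measures; mass 0 is separate
  because it cannot be normalised.\<close>

lemma finite_measure_eqI_char:
  assumes "finite_measure P" "finite_measure Q"
    and sets[measurable_cong]: "sets P = sets borel" "sets Q = sets borel"
    and char: "\<And>u. char P u = char Q u"
  shows "P = Q"
proof -
  interpret P: finite_measure P by fact
  interpret Q: finite_measure Q by fact
  have sp: "space P = UNIV" "space Q = UNIV"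
    using sets_eq_imp_space_eq[OF sets(1)] sets_eq_imp_space_eq[OF sets(2)] by auto
  define c where "c = measure P UNIV"
  have c: "measure Q UNIV = c"
    using char[of 0] by (simp add: char_def c_def sp)
  show ?thesis
  proof (cases "c = 0")
    case True
    then have 0: "emeasure P UNIV = 0" "emeasure Q UNIV = 0"
      using c by (simp_all add: c_def P.emeasure_eq_measure Q.emeasure_eq_measure)
    show ?thesis
    proof (rule measure_eqI)
      fix A assume "A \<in> sets P"
      have "emeasure P A \<le> emeasure P UNIV" "emeasure Q A \<le> emeasure Q UNIV"
        by (intro emeasure_mono; simp add: sets)+
      then show "emeasure P A = emeasure Q A" by (simp add: 0)
    qed (simp add: sets)
  next
    case False
    then have cpos: "0 < c" by (simp add: c_def less_le)
    let ?n = "\<lambda>R. density R (\<lambda>_. ennreal (1 / c))"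
    have dist: "real_distribution (?n R)"
      if "finite_measure R" "sets R = sets borel" "measure R UNIV = c" for R
    proof -
      interpret finite_measure R by fact
      have "space R = UNIV" using sets_eq_imp_space_eq[OF that(2)] by simp
      then have "emeasure (?n R) (space (?n R)) = 1"
        using that cpos
        by (subst emeasure_density_const) (auto simp: emeasure_eq_measure ennreal_mult[symmetric])
      then show ?thesis
        by (intro real_distribution.intro real_distribution_axioms.intro prob_spaceI) (auto simp: that)
    qed
    have "?n P = ?n Q"
    proof (rule Levy_uniqueness)
      show "char (?n P) = char (?n Q)"
        using char cpos by (auto simp: char_def integral_density fun_eq_iff)
    qed (rule dist[OF assms(1) sets(1) c_def[symmetric]], rule dist[OF assms(2) sets(2) c])
    then have eq: "ennreal (1 / c) * emeasure P A = ennreal (1 / c) * emeasure Q A" if "A \<in> sets borel" for A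
      using that emeasure_density_const[of A P "ennreal (1 / c)"] emeasure_density_const[of A Q "ennreal (1 / c)"]
      by (simp add: sets)
    show ?thesis
    proof (rule measure_eqI)
      fix A assume "A \<in> sets P"
      then have "A \<in> sets borel" by (simp add: sets)
      from eq[OF this] show "emeasure P A = emeasure Q A"
        using cpos by (simp add: ennreal_mult_cancel_left)
    qed (simp add: sets)
  qed
qed

text \<open>The hypothesis compares the characteristic functions of the images under
  \<open>f\<close> of the finite measures with densities \<open>w\<close>. These images therefore
  coincide, and the conclusion evaluates them on \<open>B\<close>.\<close>

lemma weighted_char_unique:
  fixes w f :: "'b \<Rightarrow> real"
  assumes sets[measurable_cong]: "sets Q = sets P"
    and [measurable]: "f \<in> borel_measurable P" "B \<in> sets borel"
    and w: "integrable P w" "integrable Q w" "\<And>x. 0 \<le> w x"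
    and eq: "\<And>u. (\<integral>x. w x *\<^sub>R iexp (u * f x) \<partial>P) = (\<integral>x. w x *\<^sub>R iexp (u * f x) \<partial>Q)"
  shows "(\<integral>x. w x * indicator B (f x) \<partial>P) = (\<integral>x. w x * indicator B (f x) \<partial>Q)"
proof -
  have [measurable]: "w \<in> borel_measurable P" using w by simp
  let ?D = "\<lambda>R. distr (density R (\<lambda>x. ennreal (w x))) borel f"
  have fin: "finite_measure (?D R)" if [measurable_cong]: "sets R = sets P" and "integrable R w" for R
  proof (intro finite_measureI)
    have "emeasure (?D R) (space (?D R)) = (\<integral>\<^sup>+x. ennreal (w x) * indicator (f -` UNIV \<inter> space R) x \<partial>R)"
      by (subst emeasure_distr) (auto simp: emeasure_density)
    also have "\<dots> = (\<integral>\<^sup>+x. ennreal (w x) \<partial>R)"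
      by (intro nn_integral_cong) auto
    also have "\<dots> = ennreal (\<integral>x. w x \<partial>R)"
      using that w by (intro nn_integral_eq_integral) auto
    finally show "emeasure (?D R) (space (?D R)) \<noteq> \<infinity>" by simp
  qed
  have "?D P = ?D Q"
  proof (rule finite_measure_eqI_char)
    fix u
    show "char (?D P) u = char (?D Q) u"
      unfolding char_def using eq[of u] w(3)
      by (subst (1 2) integral_distr) (auto simp: integral_density)
  qed (simp_all add: fin[OF refl w(1)] fin[OF sets w(2)])
  then have "(\<integral>y. indicator B y \<partial>?D P) = (\<integral>y. (indicator B y :: real) \<partial>?D Q)" by simp
  then show ?thesis
    using w(3) by (subst (asm) (1 2) integral_distr) (auto simp: integral_density)
qed

text \<open>Induction over the coordinates: one exponential factor at a time is traded for an indicator.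
  The uniqueness theorem on the line needs nonnegative weights, so \<open>iexp S\<close> is recovered from
  the weights \<open>1\<close>, \<open>1 + cos S\<close> and \<open>1 + sin S\<close>.\<close>

lemma joint_char_indicators:
  fixes f :: "'i \<Rightarrow> 'b \<Rightarrow> real"
  assumes "finite_measure P" "finite_measure Q" and sets[measurable_cong]: "sets Q = sets P"
    and I: "finite I" and f: "\<And>i. i \<in> I \<Longrightarrow> f i \<in> borel_measurable P"
    and char: "\<And>a. (\<integral>x. iexp (\<Sum>i\<in>I. a i * f i x) \<partial>P) = (\<integral>x. iexp (\<Sum>i\<in>I. a i * f i x) \<partial>Q)"
    and J: "J \<subseteq> I" and A: "\<And>j. j \<in> J \<Longrightarrow> A j \<in> sets borel"
  shows "(\<integral>x. (\<Prod>j\<in>J. indicator (A j) (f j x)) *\<^sub>R iexp (\<Sum>i\<in>I. a i * f i x) \<partial>P)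
       = (\<integral>x. (\<Prod>j\<in>J. indicator (A j) (f j x)) *\<^sub>R iexp (\<Sum>i\<in>I. a i * f i x) \<partial>Q)"
proof -
  have "finite J" using J I by (rule finite_subset)
  then show ?thesis using J A
  proof (induction J arbitrary: a rule: finite_induct)
    case empty
    then show ?case using char[of a] by simp
  next
    case (insert k J)
    interpret P: finite_measure P by fact
    interpret Q: finite_measure Q by fact
    have k: "k \<in> I" and J: "J \<subseteq> I" and Ak[measurable]: "A k \<in> sets borel"
      using insert.prems by auto
    define w where "w x = (\<Prod>j\<in>J. indicator (A j) (f j x) :: real)" for x
    define S where "S x = (\<Sum>i\<in>I. a i * f i x)" for x
    have [measurable]: "S \<in> borel_measurable P" "f k \<in> borel_measurable P"
      using f k by (auto simp: S_def[abs_def] intro!: borel_measurable_sum)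
    have "(\<lambda>x. indicator (A j) (f j x) :: real) \<in> borel_measurable P" if "j \<in> J" for j
      using f[of j] insert.prems that
      by (intro measurable_compose[OF _ borel_measurable_indicator]) auto
    then have [measurable]: "w \<in> borel_measurable P"
      unfolding w_def[abs_def] by (intro borel_measurable_prod) auto
    have w: "0 \<le> w x" "w x \<le> 1" for x
      unfolding w_def by (auto intro!: prod_nonneg prod_le_1 simp: indicator_def)
    \<comment> \<open>Only c = 0, 1, -1 are used. They provide the weights 1, exp (i S) and exp (-i
      S), hence cosine and sine of S, while u runs through the frequencies of coordinate
      \<open>k\<close>.\<close>
    have E: "(\<integral>x. w x *\<^sub>R iexp (c * S x + u * f k x) \<partial>P) = (\<integral>x. w x *\<^sub>R iexp (c * S x + u * f k x) \<partial>Q)" for c u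
    proof -
      have "c * S x + u * f k x = (\<Sum>i\<in>I. (c * a i + (if i = k then u else 0)) * f i x)" for x
        using I k by (simp add: S_def distrib_right sum.distrib sum_distrib_left if_distrib[of "\<lambda>z. z * _"] mult.assoc
            sum.delta cong: if_cong)
      then show ?thesis
        using insert.IH[of "\<lambda>i. c * a i + (if i = k then u else 0)"] J insert.prems
        by (simp only: w_def) auto
    qed
    have int: "integrable P g \<and> integrable Q g"
      if [measurable]: "g \<in> borel_measurable P" and "\<And>x. norm (g x) \<le> 2" for g :: "'b \<Rightarrow> 'c::{banach,second_countable_topology}"
      using that by (auto intro!: P.integrable_const_bound[where B=2] Q.integrable_const_bound[where B=2])
    have le2: "\<bar>w x * y\<bar> \<le> 2" if "\<bar>y\<bar> \<le> 2" for x y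
      using mult_mono[OF w(2)[of x] that] w(1)[of x] by (simp add: abs_mult)
    have cs2: "\<bar>1 + cos y\<bar> \<le> 2" "\<bar>1 + sin y\<bar> \<le> 2" for y :: real
      using cos_le_one[of y] cos_ge_minus_one[of y] sin_le_one[of y] sin_ge_minus_one[of y] by (auto simp: abs_le_iff simp del: cos_le_one cos_ge_minus_one sin_le_one sin_ge_minus_one)
    have le2': "w x * y \<le> 2" if "\<bar>y\<bar> \<le> 2" for x y
      using le2[OF that] abs_le_D1 by blast
    have cs0: "0 \<le> 1 + cos y" "0 \<le> 1 + sin y" for y :: real
      using cos_ge_minus_one[of y] sin_ge_minus_one[of y] by linarith+
    have W: "(\<integral>x. g x * indicator (A k) (f k x) \<partial>P) = (\<integral>x. g x * indicator (A k) (f k x) \<partial>Q)"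
      if g[measurable]: "g \<in> borel_measurable P" "\<And>x. 0 \<le> g x" "\<And>x. \<bar>g x\<bar> \<le> 2"
        and eq: "\<And>u. (\<integral>x. g x *\<^sub>R iexp (u * f k x) \<partial>P) = (\<integral>x. g x *\<^sub>R iexp (u * f k x) \<partial>Q)" for g
      using int[of g] g eq by (intro weighted_char_unique[OF sets]) auto
    have i1: "integrable P (\<lambda>x. w x *\<^sub>R iexp (c * S x + u * f k x)) \<and> integrable Q (\<lambda>x. w x *\<^sub>R iexp (c * S x + u * f k x))" for c u
      using w by (intro int) (auto simp: norm_mult le2 intro: order.trans[of _ 1])
    have W1: "(\<integral>x. w x * indicator (A k) (f k x) \<partial>P) = (\<integral>x. w x * indicator (A k) (f k x) \<partial>Q)"
      using E[of 0] w by (intro W) (auto intro: order.trans[of _ 1])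
    have ce: "complex_of_real (cos y) = (iexp (1 * y) + iexp (-1 * y)) / 2"
      and se: "complex_of_real (sin y) = (iexp (1 * y) - iexp (-1 * y)) / (2 * \<i>)" for y
      by (simp_all add: cos_of_real[symmetric] cos_exp_eq sin_of_real[symmetric] sin_exp_eq)
    have ex: "iexp (c * S x + u * f k x) = iexp (c * S x) * iexp (u * f k x)" for c x u
      by (simp add: exp_add[symmetric] distrib_left)
    have e0: "iexp (0 * y) = 1" for y by simp
    have alg1: "a * (1 + (b + c) / 2) * d = a * (1 * d) + 1 / 2 * (a * (b * d)) + 1 / 2 * (a * (c * d))"
      and alg2: "a * (1 + (b - c) / (2 * \<i>)) * d
        = a * (1 * d) + 1 / (2 * \<i>) * (a * (b * d)) + - 1 / (2 * \<i>) * (a * (c * d))" for a b c d :: complex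
      by (simp_all add: field_simps)
    have cosw: "(w x * (1 + cos (S x))) *\<^sub>R iexp (u * f k x) = w x *\<^sub>R iexp (0 * S x + u * f k x)
        + (1/2) * (w x *\<^sub>R iexp (1 * S x + u * f k x)) + (1/2) * (w x *\<^sub>R iexp (-1 * S x + u * f k x))" for x u
      unfolding ex scaleR_conv_of_real of_real_mult[of "w x"] of_real_add[of 1] of_real_1 ce e0
      by (rule alg1)
    have W2: "(\<integral>x. (w x * (1 + cos (S x))) * indicator (A k) (f k x) \<partial>P) = (\<integral>x. (w x * (1 + cos (S x))) * indicator (A k) (f k x) \<partial>Q)"
    proof (rule W)
      fix u
      show "(\<integral>x. (w x * (1 + cos (S x))) *\<^sub>R iexp (u * f k x) \<partial>P) = (\<integral>x. (w x * (1 + cos (S x))) *\<^sub>R iexp (u * f k x) \<partial>Q)"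
        unfolding cosw using E i1
        by (simp only: Bochner_Integration.integral_add integrable_mult_right integral_mult_right_zero Bochner_Integration.integrable_add simp_thms)
    qed (use w cs2 in \<open>auto intro!: le2 le2' mult_nonneg_nonneg simp: cs0\<close>)
    have sinw: "(w x * (1 + sin (S x))) *\<^sub>R iexp (u * f k x) = w x *\<^sub>R iexp (0 * S x + u * f k x)
        + (1/(2*\<i>)) * (w x *\<^sub>R iexp (1 * S x + u * f k x)) + (-1/(2*\<i>)) * (w x *\<^sub>R iexp (-1 * S x + u * f k x))" for x u
      unfolding ex scaleR_conv_of_real of_real_mult[of "w x"] of_real_add[of 1] of_real_1 se e0
      by (rule alg2)
    have W3: "(\<integral>x. (w x * (1 + sin (S x))) * indicator (A k) (f k x) \<partial>P) = (\<integral>x. (w x * (1 + sin (S x))) * indicator (A k) (f k x) \<partial>Q)"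
    proof (rule W)
      fix u
      show "(\<integral>x. (w x * (1 + sin (S x))) *\<^sub>R iexp (u * f k x) \<partial>P) = (\<integral>x. (w x * (1 + sin (S x))) *\<^sub>R iexp (u * f k x) \<partial>Q)"
        unfolding sinw using E i1
        by (simp only: Bochner_Integration.integral_add integrable_mult_right integral_mult_right_zero Bochner_Integration.integrable_add simp_thms)
    qed (use w cs2 in \<open>auto intro!: le2 le2' mult_nonneg_nonneg simp: cs0\<close>)
    let ?i = "\<lambda>x. indicator (A k) (f k x) :: real"
    \<comment> \<open>The shifts by 1 that made the weights nonnegative are undone: exp (i S) = (1 +
      cos S) - 1 + i ((1 + sin S) - 1).\<close>
    have decomp: "(\<Prod>j\<in>insert k J. indicator (A j) (f j x)) *\<^sub>R iexp (\<Sum>i\<in>I. a i * f i x)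
      = of_real ((w x * (1 + cos (S x))) * ?i x) - of_real (w x * ?i x)
        + \<i> * (of_real ((w x * (1 + sin (S x))) * ?i x) - of_real (w x * ?i x))" for x
      unfolding S_def[symmetric] using insert.hyps
      by (simp add: w_def[symmetric] scaleR_conv_of_real exp_Euler cos_of_real sin_of_real algebra_simps)
    have i2: "integrable P (\<lambda>x. g x * ?i x)" "integrable Q (\<lambda>x. g x * ?i x)"
      if [measurable]: "g \<in> borel_measurable P" and "\<And>x. \<bar>g x\<bar> \<le> 2" for g
    proof -
      have "\<bar>g x * ?i x\<bar> \<le> 2" for x using that(2)[of x] by (auto simp: indicator_def)
      then show "integrable P (\<lambda>x. g x * ?i x)" "integrable Q (\<lambda>x. g x * ?i x)"
        using int[of "\<lambda>x. g x * ?i x"] by auto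
    qed
    have i3: "integrable P (\<lambda>x. w x * ?i x)" "integrable Q (\<lambda>x. w x * ?i x)"
      "integrable P (\<lambda>x. (w x * (1 + cos (S x))) * ?i x)" "integrable Q (\<lambda>x. (w x * (1 + cos (S x))) * ?i x)"
      "integrable P (\<lambda>x. (w x * (1 + sin (S x))) * ?i x)" "integrable Q (\<lambda>x. (w x * (1 + sin (S x))) * ?i x)"
      by (rule i2, measurable, use w cs2 in \<open>auto intro!: le2 intro: order.trans[of _ 1]\<close>)+
    show ?case
      unfolding decomp
      by (simp only: i3 W1 W2 W3 Bochner_Integration.integral_add Bochner_Integration.integral_diff
          integrable_mult_right integral_mult_right_zero Bochner_Integration.integrable_diff
          integral_of_real integrable_of_real)
  qed
qed

lemma joint_char_measure:
  fixes f :: "'i \<Rightarrow> 'b \<Rightarrow> real"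
  assumes "finite_measure P" "finite_measure Q" and sets[measurable_cong]: "sets Q = sets P"
    and I: "finite I" and f: "\<And>i. i \<in> I \<Longrightarrow> f i \<in> borel_measurable P"
    and char: "\<And>a. (\<integral>x. iexp (\<Sum>i\<in>I. a i * f i x) \<partial>P) = (\<integral>x. iexp (\<Sum>i\<in>I. a i * f i x) \<partial>Q)"
    and A: "\<And>j. j \<in> I \<Longrightarrow> A j \<in> sets borel"
  shows "emeasure P {x\<in>space P. \<forall>i\<in>I. f i x \<in> A i} = emeasure Q {x\<in>space P. \<forall>i\<in>I. f i x \<in> A i}"
proof -
  interpret P: finite_measure P by fact
  interpret Q: finite_measure Q by fact
  have sp: "space Q = space P" using sets by (rule sets_eq_imp_space_eq)
  let ?X = "{x\<in>space P. \<forall>i\<in>I. f i x \<in> A i}"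
  have "{x \<in> space P. f i x \<in> A i} \<in> sets P" if "i \<in> I" for i
    using measurable_sets[OF f A, OF that that] by (simp add: vimage_def Int_def conj_commute)
  then have X: "?X \<in> sets P" using I by (intro sets.sets_Collect_finite_All) auto
  \<comment> \<open>With every coordinate traded for an indicator and all remaining frequencies set
    to 0, only the indicator of the box is left.\<close>
  have ind: "(\<Prod>j\<in>I. indicator (A j) (f j x)) *\<^sub>R iexp (\<Sum>i\<in>I. 0 * f i x) = of_real (indicator ?X x)"
    if "x \<in> space P" for x
    using that I by (auto simp: indicator_def scaleR_conv_of_real prod_zero_iff split: if_splits)
  have "(\<integral>x. complex_of_real (indicator ?X x) \<partial>P) = (\<integral>x. complex_of_real (indicator ?X x) \<partial>Q)"
  proof -
    have eq: "(\<integral>x. complex_of_real (indicator ?X x) \<partial>R)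
        = (\<integral>x. (\<Prod>j\<in>I. indicator (A j) (f j x)) *\<^sub>R iexp (\<Sum>i\<in>I. 0 * f i x) \<partial>R)" if "space R = space P" for R
      using that by (intro Bochner_Integration.integral_cong refl ind[symmetric]) simp
    show ?thesis
      unfolding eq[OF refl] eq[OF sp]
      by (rule joint_char_indicators[OF assms(1-4)]) (use f char A in auto)
  qed
  then have "measure P ?X = measure Q ?X"
    using X by (simp add: sets sp)
  then show ?thesis by (simp add: P.emeasure_eq_measure Q.emeasure_eq_measure)
qed

lemma PiM_borel_eqI_char:
  fixes P Q :: "('i \<Rightarrow> real) measure"
  assumes "finite_measure P" "finite_measure Q" and I: "finite I"
    and sets: "sets P = sets (\<Pi>\<^sub>M i\<in>I. borel)" "sets Q = sets (\<Pi>\<^sub>M i\<in>I. borel)"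
    and char: "\<And>a. (\<integral>x. iexp (\<Sum>i\<in>I. a i * x i) \<partial>P) = (\<integral>x. iexp (\<Sum>i\<in>I. a i * x i) \<partial>Q)"
  shows "P = Q"
proof -
  interpret P: finite_measure P by fact
  have spP: "space P = (\<Pi>\<^sub>E i\<in>I. UNIV)"
    using sets_eq_imp_space_eq[OF sets(1)] by (simp add: space_PiM)
  show ?thesis
  proof (rule measure_eqI_PiM_finite[OF I sets])
    fix A :: "'i \<Rightarrow> real set" assume A: "\<And>i. i \<in> I \<Longrightarrow> A i \<in> sets borel"
    have "{x \<in> space P. \<forall>i\<in>I. x i \<in> A i} = Pi\<^sub>E I A"
      unfolding spP by (auto simp: PiE_iff extensional_def)
    moreover have "emeasure P {x \<in> space P. \<forall>i\<in>I. x i \<in> A i} = emeasure Q {x \<in> space P. \<forall>i\<in>I. x i \<in> A i}"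
    proof (rule joint_char_measure[OF assms(1,2) _ I _ char A])
      show "sets Q = sets P" using sets by simp
      show "(\<lambda>x. x i) \<in> borel_measurable P" if "i \<in> I" for i
        using that by (subst measurable_cong_sets[OF sets(1) refl]) (rule measurable_component_singleton)
    qed
    ultimately show "emeasure P (Pi\<^sub>E I A) = emeasure Q (Pi\<^sub>E I A)" by simp
  next
    show "range (\<lambda>_::nat. space P) \<subseteq> prod_algebra I (\<lambda>_. borel)"
      unfolding spP using I by (auto intro!: prod_algebraI_finite)
    show "(\<Union>i::nat. space P) = space (\<Pi>\<^sub>M i\<in>I. borel)"
      using sets_eq_imp_space_eq[OF sets(1)] by simp
    show "emeasure P (space P) \<noteq> \<infinity>" by simp
  qed
qed

text \<open>A complex vector is a real one indexed by \<open>I \<times> UNIV\<close>, with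
  \<open>True\<close> for real and \<open>False\<close> for imaginary parts. A real linear form a Re
  z + b Im z is Re ((a - ib) z), so complex coefficients in the hypothesis reach every real linear
  form.\<close>

lemma (in prob_space) distr_complex_vector_eqI_char:
  fixes X Y :: "'i \<Rightarrow> 'a \<Rightarrow> complex"
  assumes I: "finite I"
    and X: "\<And>i. i \<in> I \<Longrightarrow> X i \<in> borel_measurable M" and Y: "\<And>i. i \<in> I \<Longrightarrow> Y i \<in> borel_measurable M"
    and char: "\<And>c. (\<integral>x. iexp (Re (\<Sum>i\<in>I. c i * X i x)) \<partial>M) = (\<integral>x. iexp (Re (\<Sum>i\<in>I. c i * Y i x)) \<partial>M)"
  shows "distr M (\<Pi>\<^sub>M i\<in>I. borel) (\<lambda>x. \<lambda>i\<in>I. X i x) = distr M (\<Pi>\<^sub>M i\<in>I. borel) (\<lambda>x. \<lambda>i\<in>I. Y i x)"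
proof -
  let ?J = "I \<times> (UNIV :: bool set)"
  let ?R = "\<Pi>\<^sub>M j\<in>?J. (borel :: real measure)"
  let ?r = "\<lambda>Z x. \<lambda>(i, b)\<in>?J. if b then Re (Z i x) else Im (Z i x :: complex)"
  let ?c = "\<lambda>y. \<lambda>i\<in>I. Complex (y (i, True)) (y (i, False))"
  have r: "?r Z \<in> measurable M ?R" if "\<And>i. i \<in> I \<Longrightarrow> Z i \<in> borel_measurable M" for Z
  proof (rule measurable_restrict)
    fix j assume "j \<in> ?J"
    then show "(\<lambda>x. case j of (i, b) \<Rightarrow> if b then Re (Z i x) else Im (Z i x)) \<in> borel_measurable M"
      using that[of "fst j"] by (cases j) auto
  qed
  have c: "?c \<in> measurable ?R (\<Pi>\<^sub>M i\<in>I. borel)"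
  proof (rule measurable_restrict)
    fix i assume "i \<in> I"
    then have "(\<lambda>y. y (i, b)) \<in> borel_measurable ?R" for b
      by (intro measurable_component_singleton) simp
    then have "(\<lambda>y. complex_of_real (y (i, True)) + \<i> * complex_of_real (y (i, False))) \<in> borel_measurable ?R"
      by (intro borel_measurable_add borel_measurable_times borel_measurable_const measurable_compose[OF _ borel_measurable_of_real] ) auto
    then show "(\<lambda>y. Complex (y (i, True)) (y (i, False))) \<in> borel_measurable ?R"
      by (simp add: Complex_eq)
  qed
  have recover: "distr M (\<Pi>\<^sub>M i\<in>I. borel) (\<lambda>x. \<lambda>i\<in>I. Z i x) = distr (distr M ?R (?r Z)) (\<Pi>\<^sub>M i\<in>I. borel) ?c"
    if "\<And>i. i \<in> I \<Longrightarrow> Z i \<in> borel_measurable M" for Z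
  proof -
    have "distr (distr M ?R (?r Z)) (\<Pi>\<^sub>M i\<in>I. borel) ?c = distr M (\<Pi>\<^sub>M i\<in>I. borel) (?c \<circ> ?r Z)"
      by (rule distr_distr[OF c r[OF that]])
    also have "?c \<circ> ?r Z = (\<lambda>x. \<lambda>i\<in>I. Z i x)"
      by (auto simp: comp_def fun_eq_iff complex_eq_iff restrict_def)
    finally show ?thesis ..
  qed
  have int: "(\<integral>y. iexp (\<Sum>j\<in>?J. a j * y j) \<partial>distr M ?R (?r Z))
      = (\<integral>x. iexp (Re (\<Sum>i\<in>I. Complex (a (i, True)) (- a (i, False)) * Z i x)) \<partial>M)"
    if Z: "\<And>i. i \<in> I \<Longrightarrow> Z i \<in> borel_measurable M" for Z a
  proof -
    have "(\<lambda>y. \<Sum>j\<in>?J. a j * y j) \<in> borel_measurable ?R"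
      by (intro borel_measurable_sum borel_measurable_times borel_measurable_const measurable_component_singleton)
    then have "(\<lambda>y. iexp (\<Sum>j\<in>?J. a j * y j)) \<in> borel_measurable ?R" by measurable
    then have "(\<integral>y. iexp (\<Sum>j\<in>?J. a j * y j) \<partial>distr M ?R (?r Z)) = (\<integral>x. iexp (\<Sum>j\<in>?J. a j * ?r Z x j) \<partial>M)"
      by (intro integral_distr r Z)
    moreover have "(\<Sum>j\<in>?J. a j * ?r Z x j) = Re (\<Sum>i\<in>I. Complex (a (i, True)) (- a (i, False)) * Z i x)" for x
    proof -
      have "(\<Sum>j\<in>?J. a j * ?r Z x j) = (\<Sum>i\<in>I. \<Sum>b\<in>UNIV. a (i, b) * ?r Z x (i, b))"
        unfolding sum.cartesian_product by (intro sum.cong refl) auto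
      also have "\<dots> = (\<Sum>i\<in>I. a (i, True) * Re (Z i x) + a (i, False) * Im (Z i x))"
        by (intro sum.cong refl) (simp add: UNIV_bool)
      finally show ?thesis by (simp add: Re_sum)
    qed
    ultimately show ?thesis by (simp only:)
  qed
  have "distr M ?R (?r X) = distr M ?R (?r Y)"
  proof (rule PiM_borel_eqI_char)
    show "finite_measure (distr M ?R (?r X))" "finite_measure (distr M ?R (?r Y))"
      using prob_space_distr[OF r[OF X]] prob_space_distr[OF r[OF Y]]
      by (auto intro: prob_space.finite_measure)
  next
    fix a :: "'i \<times> bool \<Rightarrow> real"
    show "(\<integral>y. iexp (\<Sum>j\<in>?J. a j * y j) \<partial>distr M ?R (?r X)) = (\<integral>y. iexp (\<Sum>j\<in>?J. a j * y j) \<partial>distr M ?R (?r Y))"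
      by (rule trans[OF int[OF X] trans[OF char int[OF Y, symmetric]]])
  qed (use I in auto)
  then show ?thesis by (simp add: recover[OF X] recover[OF Y])
qed

section \<open>Fourier transforms of integrable functions\<close>

lemma integrable_iexp_mult:
  fixes f :: "real \<Rightarrow> complex"
  assumes f: "integrable lborel f"
  shows "integrable lborel (\<lambda>t. exp (\<i> * of_real (c * t)) * f t)"
proof (rule Bochner_Integration.integrable_bound[OF f])
  show "(\<lambda>t. exp (\<i> * of_real (c * t)) * f t) \<in> borel_measurable lborel"
    using f by measurable
qed (simp add: norm_mult)

lemma fourier_iexp: "fourier f \<omega> = (\<integral>t. iexp (- \<omega> * t) * f t \<partial>lborel)"
  by (simp add: fourier_def mult.commute)

lemma isCont_fourier:
  assumes f: "integrable lborel f"
  shows "isCont (fourier f) \<omega>"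
  unfolding continuous_at_sequentially comp_def
proof (intro allI impI)
  fix X assume X: "X \<longlonglongrightarrow> \<omega>"
  show "(\<lambda>n. fourier f (X n)) \<longlonglongrightarrow> fourier f \<omega>"
    unfolding fourier_iexp
  proof (rule integral_dominated_convergence[where w="\<lambda>t. norm (f t)"])
    show "AE t in lborel. (\<lambda>n. iexp (- X n * t) * f t) \<longlonglongrightarrow> iexp (- \<omega> * t) * f t"
      by (intro always_eventually allI tendsto_intros X)
  qed (use f in \<open>auto intro: borel_measurable_integrable[OF integrable_iexp_mult] simp: norm_mult\<close>)
qed

lemma fourier_add:
  "integrable lborel f \<Longrightarrow> integrable lborel g \<Longrightarrow> fourier (\<lambda>t. f t + g t) \<omega> = fourier f \<omega> + fourier g \<omega>"
  unfolding fourier_iexp distrib_left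
  by (intro Bochner_Integration.integral_add integrable_iexp_mult)

lemma fourier_diff:
  "integrable lborel f \<Longrightarrow> integrable lborel g \<Longrightarrow> fourier (\<lambda>t. f t - g t) \<omega> = fourier f \<omega> - fourier g \<omega>"
  unfolding fourier_iexp right_diff_distrib
  by (intro Bochner_Integration.integral_diff integrable_iexp_mult)

lemma fourier_cmult: "fourier (\<lambda>t. c * f t) \<omega> = c * fourier f \<omega>"
  unfolding fourier_iexp by (simp add: mult.left_commute)

lemma fourier_sum:
  "(\<And>i. i \<in> I \<Longrightarrow> integrable lborel (f i)) \<Longrightarrow> fourier (\<lambda>t. \<Sum>i\<in>I. f i t) \<omega> = (\<Sum>i\<in>I. fourier (f i) \<omega>)"
  unfolding fourier_iexp sum_distrib_left
  by (intro Bochner_Integration.integral_sum integrable_iexp_mult)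

lemma fourier_cnj: "fourier (\<lambda>t. cnj (f t)) \<omega> = cnj (fourier f (- \<omega>))"
proof -
  have "fourier (\<lambda>t. cnj (f t)) \<omega> = (\<integral>t. cnj (iexp (- (- \<omega>) * t) * f t) \<partial>lborel)"
    unfolding fourier_iexp by (intro Bochner_Integration.integral_cong) (simp_all add: exp_cnj)
  then show ?thesis by (simp only: Bochner_Integration.integral_cnj fourier_iexp)
qed

text \<open>The Jacobian of \<tau> = t + s u cancels the factor 1 / s. The shift by t survives only
  as a phase, which later drops out of all moduli.\<close>

lemma fourier_affine:
  assumes "s > 0"
  shows "fourier (\<lambda>\<tau>. 1 / of_real s * f ((\<tau> - t) / s)) \<omega> = iexp (- \<omega> * t) * fourier f (s * \<omega>)"
proof -
  have "fourier (\<lambda>\<tau>. 1 / of_real s * f ((\<tau> - t) / s)) \<omega>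
      = \<bar>s\<bar> *\<^sub>R (\<integral>u. iexp (- \<omega> * (t + s * u)) * (1 / of_real s * f ((t + s * u - t) / s)) \<partial>lborel)"
    unfolding fourier_iexp using assms by (intro lborel_integral_real_affine) simp
  also have "\<dots> = (\<integral>u. iexp (- \<omega> * t) * (iexp (- (s * \<omega>) * u) * f u) \<partial>lborel)"
    using assms by (simp only: integral_scaleR_right[symmetric])
       (intro Bochner_Integration.integral_cong refl, simp add: scaleR_conv_of_real exp_add[symmetric] algebra_simps)
  also have "\<dots> = iexp (- \<omega> * t) * fourier f (s * \<omega>)"
    unfolding fourier_iexp by simp
  finally show ?thesis .
qed

lemma integrable_affine:
  fixes f :: "real \<Rightarrow> complex"
  assumes f: "integrable lborel f" and "s > 0"
  shows "integrable lborel (\<lambda>\<tau>. 1 / of_real s * f ((\<tau> - t) / s))"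
proof -
  have "integrable lborel (\<lambda>\<tau>. f (- t / s + (1 / s) * \<tau>))"
    using assms by (intro lborel_integrable_real_affine) auto
  then show ?thesis
    by (intro integrable_mult_right) (simp add: diff_divide_distrib)
qed

text \<open>Positive and negative parts of \<open>f\<close> are densities of finite measures with
  equal characteristic functions, so they agree almost everywhere. As at most one of them is nonzero
  at any point, both vanish.\<close>

lemma fourier_real_eq_0:
  fixes f :: "real \<Rightarrow> real"
  assumes f: "integrable lborel f" and 0: "\<And>\<omega>. fourier (\<lambda>t. of_real (f t)) \<omega> = 0"
  shows "AE t in lborel. f t = 0"
proof -
  have [measurable]: "f \<in> borel_measurable borel" using f by auto
  let ?p = "\<lambda>t. max 0 (f t)" and ?n = "\<lambda>t. max 0 (- f t)"
  have i: "integrable lborel ?p" "integrable lborel ?n" using f by auto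
  have fin: "finite_measure (density lborel (\<lambda>t. ennreal (g t)))"
    if "integrable lborel g" "\<And>t. 0 \<le> g t" for g :: "real \<Rightarrow> real"
  proof (rule finite_measureI)
    have "emeasure (density lborel (\<lambda>t. ennreal (g t))) (space lborel) = (\<integral>\<^sup>+t. ennreal (g t) \<partial>lborel)"
      using that by (subst emeasure_density) (auto intro!: nn_integral_cong)
    also have "\<dots> = ennreal (\<integral>t. g t \<partial>lborel)" using that by (intro nn_integral_eq_integral) auto
    finally show "emeasure (density lborel (\<lambda>t. ennreal (g t))) (space (density lborel (\<lambda>t. ennreal (g t)))) \<noteq> \<infinity>"
      by simp
  qed
  have "density lborel (\<lambda>t. ennreal (?p t)) = density lborel (\<lambda>t. ennreal (?n t))"
  proof (rule finite_measure_eqI_char)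
    fix u
    have I: "integrable lborel (\<lambda>t. iexp (u * t) * of_real (g t))" if "integrable lborel g" for g :: "real \<Rightarrow> real"
      using that by (intro integrable_iexp_mult) auto
    have "0 = (\<integral>t. iexp (u * t) * of_real (f t) \<partial>lborel)"
      using 0[of "- u"] by (simp add: fourier_iexp)
    also have "\<dots> = (\<integral>t. iexp (u * t) * of_real (?p t) - iexp (u * t) * of_real (?n t) \<partial>lborel)"
      by (intro Bochner_Integration.integral_cong) (auto simp: max_def)
    also have "\<dots> = (\<integral>t. iexp (u * t) * of_real (?p t) \<partial>lborel) - (\<integral>t. iexp (u * t) * of_real (?n t) \<partial>lborel)"
      by (intro Bochner_Integration.integral_diff I i)
    finally show "char (density lborel (\<lambda>t. ennreal (?p t))) u = char (density lborel (\<lambda>t. ennreal (?n t))) u"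
      unfolding char_def
      by (subst (1 2) integral_density) (simp_all add: scaleR_conv_of_real mult.commute)
  qed (simp_all add: fin[OF i(1)] fin[OF i(2)] del: ennreal_max_0 ennreal_max_0')
  moreover have "(\<integral>\<^sup>+t. ennreal (?p t) \<partial>lborel) \<noteq> \<infinity>"
    using i(1) by (subst nn_integral_eq_integral) auto
  ultimately have "AE t in lborel. ennreal (?p t) = ennreal (?n t)"
    by (subst (asm) finite_density_unique) auto
  then show ?thesis by eventually_elim (auto simp: max_def split: if_splits)
qed

text \<open>Conjugating a function conjugates its transform and reflects the frequency, so
  \<open>cnj\<close> of \<open>f\<close> has zero transform too. Real and imaginary parts are
  combinations of the two functions and fall under the real case.\<close>

lemma fourier_eq_0:
  assumes f: "integrable lborel f" and 0: "\<And>\<omega>. fourier f \<omega> = 0"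
  shows "AE t in lborel. f t = 0"
proof -
  have c: "fourier (\<lambda>t. cnj (f t)) \<omega> = 0" for \<omega> by (simp add: fourier_cnj 0)
  have ic: "integrable lborel (\<lambda>t. cnj (f t))" using f by simp
  have "complex_of_real (Re z) = 1/2 * z + 1/2 * cnj z" "complex_of_real (Im z) = (- \<i>/2) * z + (\<i>/2) * cnj z" for z
    by (simp_all add: complex_eq_iff)
  then have "fourier (\<lambda>t. of_real (Re (f t))) \<omega> = 0" "fourier (\<lambda>t. of_real (Im (f t))) \<omega> = 0" for \<omega>
    using f ic by (simp_all only: fourier_add fourier_cmult integrable_mult_right c 0 mult_zero_right add_0)
  then have "AE t in lborel. Re (f t) = 0" "AE t in lborel. Im (f t) = 0"
    using f by (auto intro!: fourier_real_eq_0)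
  then show ?thesis by eventually_elim (simp add: complex_eq_iff)
qed

section \<open>Squared modulus of a standard normal pair\<close>

lemma nn_integral_even_function:
  fixes f :: "real \<Rightarrow> ennreal"
  assumes [measurable]: "f \<in> borel_measurable borel" and even: "\<And>x. f (- x) = f x"
  shows "(\<integral>\<^sup>+x. f x \<partial>lborel) = 2 * (\<integral>\<^sup>+x. f x * indicator {0..} x \<partial>lborel)"
proof -
  have "(\<integral>\<^sup>+x. f x \<partial>lborel) = (\<integral>\<^sup>+x. f x * indicator {0..} x + f x * indicator {..<0} x \<partial>lborel)"
    by (intro nn_integral_cong) (auto split: split_indicator)
  also have "\<dots> = (\<integral>\<^sup>+x. f x * indicator {0..} x \<partial>lborel) + (\<integral>\<^sup>+x. f x * indicator {..<0} x \<partial>lborel)"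
    by (intro nn_integral_add) auto
  also have "(\<integral>\<^sup>+x. f x * indicator {..<0} x \<partial>lborel) = (\<integral>\<^sup>+x. f x * indicator {0<..} x \<partial>lborel)"
    by (subst nn_integral_real_affine[where c="-1" and t=0])
       (auto simp: even intro!: nn_integral_cong split: split_indicator)
  also have "\<dots> = (\<integral>\<^sup>+x. f x * indicator {0..} x \<partial>lborel)"
    by (intro nn_integral_cong_AE AE_I[where N="{0}"]) (auto split: split_indicator_asm)
  finally show ?thesis by (simp add: mult_2)
qed

lemma nn_integral_inverse_one_plus_square:
  "(\<integral>\<^sup>+s. ennreal (1 / (1 + s\<^sup>2)) \<partial>lborel) = ennreal pi"
proof -
  have "(\<integral>\<^sup>+s. ennreal (1 / (1 + s\<^sup>2)) * indicator {0..} s \<partial>lborel) = ennreal (pi / 2 - arctan 0)"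
    by (rule nn_integral_FTC_atLeast[OF _ _ _ tendsto_arctan_at_top])
       (auto intro!: derivative_eq_intros simp: field_simps add_nonneg_eq_0_iff)
  then show ?thesis
    by (subst nn_integral_even_function) (auto simp: ennreal_mult[symmetric] simp flip: ennreal_numeral)
qed

text \<open>The radial part of the Gaussian integral over a disc, applied with k = 1 + s^2. By
  evenness it is twice the integral from 0 to sqrt (2 a / k), where - exp (- x^2 k / 2) / k is an
  antiderivative.\<close>

lemma nn_integral_abs_times_exp:
  assumes k: "(k::real) > 0" and a: "a \<ge> 0"
  shows "(\<integral>\<^sup>+x. ennreal (\<bar>x\<bar> * exp (- (x\<^sup>2 * k) / 2)) * indicator {x. x\<^sup>2 * k \<le> 2 * a} x \<partial>lborel)
       = ennreal (2 * (1 - exp (- a)) / k)"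
proof -
  define b where "b = sqrt (2 * a / k)"
  have b: "0 \<le> b" "b\<^sup>2 * k = 2 * a" using k a by (auto simp: b_def)
  have iff: "x\<^sup>2 * k \<le> 2 * a \<longleftrightarrow> x \<le> b" if "0 \<le> x" for x
  proof -
    have "x\<^sup>2 * k \<le> 2 * a \<longleftrightarrow> x\<^sup>2 \<le> b\<^sup>2" using k unfolding b(2)[symmetric] by simp
    also have "\<dots> \<longleftrightarrow> x \<le> b" using that b(1) by (rule power_mono_iff) simp
    finally show ?thesis .
  qed
  have "(\<integral>\<^sup>+x. ennreal (\<bar>x\<bar> * exp (- (x\<^sup>2 * k) / 2)) * indicator {x. x\<^sup>2 * k \<le> 2 * a} x \<partial>lborel)
     = 2 * (\<integral>\<^sup>+x. ennreal (\<bar>x\<bar> * exp (- (x\<^sup>2 * k) / 2)) * indicator {x. x\<^sup>2 * k \<le> 2 * a} x * indicator {0..} x \<partial>lborel)"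
    by (rule nn_integral_even_function) (auto simp: indicator_def)
  also have "(\<integral>\<^sup>+x. ennreal (\<bar>x\<bar> * exp (- (x\<^sup>2 * k) / 2)) * indicator {x. x\<^sup>2 * k \<le> 2 * a} x * indicator {0..} x \<partial>lborel)
     = (\<integral>\<^sup>+x. ennreal (x * exp (- (x\<^sup>2 * k) / 2)) * indicator {0..b} x \<partial>lborel)"
    by (intro nn_integral_cong) (auto simp: indicator_def iff)
  also have "\<dots> = ennreal (- exp (- (b\<^sup>2 * k) / 2) / k - (- exp (- (0\<^sup>2 * k) / 2) / k))"
    using k b by (intro nn_integral_FTC_Icc) (auto intro!: derivative_eq_intros simp: field_simps)
  also have "\<dots> = ennreal ((1 - exp (- a)) / k)"
    unfolding b(2) by (simp add: diff_divide_distrib)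
  also have "2 * \<dots> = ennreal (2 * ((1 - exp (- a)) / k))"
    using k a by (subst ennreal_mult) auto
  finally show ?thesis by simp
qed

text \<open>The substitution \<open>y = x s\<close> replaces polar coordinates.\<close>

lemma emeasure_std_normal_disc:
  assumes a: "a \<ge> 0"
  shows "emeasure (std_normal_distribution \<Otimes>\<^sub>M std_normal_distribution)
           {z. ((fst z)\<^sup>2 + (snd z)\<^sup>2) / 2 \<le> a} = ennreal (1 - exp (- a))"
proof -
  let ?N = "std_normal_distribution"
  let ?D = "{z :: real \<times> real. ((fst z)\<^sup>2 + (snd z)\<^sup>2) / 2 \<le> a}"
  interpret N: prob_space ?N by (rule prob_space_normal_density) simp
  have D: "?D \<in> sets (?N \<Otimes>\<^sub>M ?N)"
  proof -
    have "?D = {z \<in> space (borel \<Otimes>\<^sub>M borel). ((fst z)\<^sup>2 + (snd z)\<^sup>2) / 2 \<le> a}"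
      by (simp add: space_pair_measure)
    also have "\<dots> \<in> sets (borel \<Otimes>\<^sub>M borel)" by measurable
    finally show ?thesis by (simp cong: sets_pair_measure_cong)
  qed
  let ?I = "\<lambda>x y. indicator ?D (x, y) :: ennreal"
  have [measurable]: "(\<lambda>z. indicator ?D z :: ennreal) \<in> borel_measurable (borel \<Otimes>\<^sub>M borel)"
    using D by (intro borel_measurable_indicator) (simp cong: sets_pair_measure_cong)
  have "emeasure (?N \<Otimes>\<^sub>M ?N) ?D = (\<integral>\<^sup>+x. \<integral>\<^sup>+y. ?I x y \<partial>?N \<partial>?N)"
    by (rule N.emeasure_pair_measure[OF D])
  also have "\<dots> = (\<integral>\<^sup>+x. ennreal (std_normal_density x) * (\<integral>\<^sup>+y. ennreal (std_normal_density y) * ?I x y \<partial>lborel) \<partial>lborel)"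
    by (subst (1 2) nn_integral_density) auto
  also have "\<dots> = (\<integral>\<^sup>+x. \<integral>\<^sup>+y. ennreal (std_normal_density x * std_normal_density y) * ?I x y \<partial>lborel \<partial>lborel)"
    by (subst nn_integral_cmult[symmetric]) (auto simp: ennreal_mult mult.assoc)
  \<comment> \<open>The substitution degenerates at x = 0, so that null set is removed first. The
    Jacobian |x| is what makes the integral over x elementary.\<close>
  also have "\<dots> = (\<integral>\<^sup>+x. \<integral>\<^sup>+s. ennreal (1 / (2 * pi)) * (ennreal (\<bar>x\<bar> * exp (- (x\<^sup>2 * (1 + s\<^sup>2)) / 2))
       * indicator {x. x\<^sup>2 * (1 + s\<^sup>2) \<le> 2 * a} x) \<partial>lborel \<partial>lborel)"
  proof (rule nn_integral_cong_AE, rule AE_mp[OF AE_lborel_singleton[of 0]], intro AE_I2 impI)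
    fix x :: real assume x: "x \<noteq> 0"
    have "(\<integral>\<^sup>+y. ennreal (std_normal_density x * std_normal_density y) * ?I x y \<partial>lborel)
      = ennreal \<bar>x\<bar> * (\<integral>\<^sup>+s. ennreal (std_normal_density x * std_normal_density (0 + x * s)) * ?I x (0 + x * s) \<partial>lborel)"
      using x by (intro nn_integral_real_affine) auto
    also have "\<dots> = (\<integral>\<^sup>+s. ennreal \<bar>x\<bar> * (ennreal (std_normal_density x * std_normal_density (0 + x * s)) * ?I x (0 + x * s)) \<partial>lborel)"
      by (intro nn_integral_cmult[symmetric]) measurable
    also have "\<dots> = (\<integral>\<^sup>+s. ennreal (1 / (2 * pi)) * (ennreal (\<bar>x\<bar> * exp (- (x\<^sup>2 * (1 + s\<^sup>2)) / 2))
       * indicator {x. x\<^sup>2 * (1 + s\<^sup>2) \<le> 2 * a} x) \<partial>lborel)"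
    proof (intro nn_integral_cong)
      fix s :: real
      have i: "?I x (0 + x * s) = indicator {x. x\<^sup>2 * (1 + s\<^sup>2) \<le> 2 * a} x"
        by (auto simp: indicator_def power_mult_distrib field_simps)
      have "\<bar>x\<bar> * (std_normal_density x * std_normal_density (0 + x * s)) = 1 / (2 * pi) * (\<bar>x\<bar> * exp (- (x\<^sup>2 * (1 + s\<^sup>2)) / 2))"
        by (simp add: std_normal_density_def mult_exp_exp power_mult_distrib field_simps real_sqrt_mult)
      then show "ennreal \<bar>x\<bar> * (ennreal (std_normal_density x * std_normal_density (0 + x * s)) * ?I x (0 + x * s))
        = ennreal (1 / (2 * pi)) * (ennreal (\<bar>x\<bar> * exp (- (x\<^sup>2 * (1 + s\<^sup>2)) / 2)) * indicator {x. x\<^sup>2 * (1 + s\<^sup>2) \<le> 2 * a} x)"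
        unfolding i by (simp add: mult.assoc[symmetric] ennreal_mult[symmetric] del: ennreal_mult'')
    qed
    finally show "(\<integral>\<^sup>+y. ennreal (std_normal_density x * std_normal_density y) * ?I x y \<partial>lborel)
      = (\<integral>\<^sup>+s. ennreal (1 / (2 * pi)) * (ennreal (\<bar>x\<bar> * exp (- (x\<^sup>2 * (1 + s\<^sup>2)) / 2))
       * indicator {x. x\<^sup>2 * (1 + s\<^sup>2) \<le> 2 * a} x) \<partial>lborel)" .
  qed
  \<comment> \<open>For a fixed slope s the integration over x comes first, since it has a closed
    form. What remains is the integral of 1 / (1 + s^2), whose value pi cancels the normalising
    constant.\<close>
  also have "\<dots> = (\<integral>\<^sup>+s. \<integral>\<^sup>+x. ennreal (1 / (2 * pi)) * (ennreal (\<bar>x\<bar> * exp (- (x\<^sup>2 * (1 + s\<^sup>2)) / 2))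
       * indicator {x. x\<^sup>2 * (1 + s\<^sup>2) \<le> 2 * a} x) \<partial>lborel \<partial>lborel)"
    by (rule lborel_pair.Fubini') (simp add: indicator_def case_prod_beta')
  also have "\<dots> = (\<integral>\<^sup>+s. ennreal (1 / (2 * pi)) * ennreal (2 * (1 - exp (- a)) / (1 + s\<^sup>2)) \<partial>lborel)"
    by (intro nn_integral_cong, subst nn_integral_cmult, measurable, subst nn_integral_abs_times_exp)
       (auto intro: a add_pos_nonneg)
  also have "\<dots> = (\<integral>\<^sup>+s. ennreal ((1 - exp (- a)) / pi) * ennreal (1 / (1 + s\<^sup>2)) \<partial>lborel)"
  proof (intro nn_integral_cong)
    fix s :: real
    have nonneg: "0 \<le> 1 / (2 * pi)" "0 \<le> 2 * (1 - exp (- a)) / (1 + s\<^sup>2)"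
      "0 \<le> (1 - exp (- a)) / pi" "0 \<le> 1 / (1 + s\<^sup>2)"
      using a by auto
    have "1 / (2 * pi) * (2 * c / d) = c / pi * (1 / d)" for c d :: real by simp
    then show "ennreal (1 / (2 * pi)) * ennreal (2 * (1 - exp (- a)) / (1 + s\<^sup>2))
      = ennreal ((1 - exp (- a)) / pi) * ennreal (1 / (1 + s\<^sup>2))"
      by (simp only: ennreal_mult[OF nonneg(1,2), symmetric] ennreal_mult[OF nonneg(3,4), symmetric])
  qed
  also have "\<dots> = ennreal ((1 - exp (- a)) / pi) * ennreal pi"
    by (subst nn_integral_cmult) (auto simp: nn_integral_inverse_one_plus_square)
  also have "\<dots> = ennreal (1 - exp (- a))"
    using a by (simp add: ennreal_mult[symmetric])
  finally show ?thesis .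
qed

text \<open>The normal mass 1 - exp (- a) of the disc of radius sqrt (2 a) is the distribution
  function of the exponential law. Division by 2 brings the mean to one.\<close>

lemma (in prob_space) exponential_of_std_normal_pair:
  assumes [measurable]: "X \<in> borel_measurable M" "Y \<in> borel_measurable M"
    and XY: "distr M (borel \<Otimes>\<^sub>M borel) (\<lambda>x. (X x, Y x)) = std_normal_distribution \<Otimes>\<^sub>M std_normal_distribution"
  shows "distributed M lborel (\<lambda>x. ((X x)\<^sup>2 + (Y x)\<^sup>2) / 2) (exponential_density 1)"
proof (rule exponential_distributedI)
  fix a :: real assume a: "0 \<le> a"
  let ?D = "{z :: real \<times> real. ((fst z)\<^sup>2 + (snd z)\<^sup>2) / 2 \<le> a}"
  have D: "?D \<in> sets (borel \<Otimes>\<^sub>M borel)"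
  proof -
    have "?D = {z \<in> space (borel \<Otimes>\<^sub>M borel). ((fst z)\<^sup>2 + (snd z)\<^sup>2) / 2 \<le> a}"
      by (simp add: space_pair_measure)
    also have "\<dots> \<in> sets (borel \<Otimes>\<^sub>M borel)" by measurable
    finally show ?thesis .
  qed
  have "emeasure M {x \<in> space M. ((X x)\<^sup>2 + (Y x)\<^sup>2) / 2 \<le> a} = emeasure (distr M (borel \<Otimes>\<^sub>M borel) (\<lambda>x. (X x, Y x))) ?D"
    using D by (subst emeasure_distr) (auto intro!: arg_cong[where f="emeasure M"])
  also have "\<dots> = ennreal (1 - exp (- a))"
    unfolding XY by (rule emeasure_std_normal_disc[OF a])
  finally show "emeasure M {x \<in> space M. ((X x)\<^sup>2 + (Y x)\<^sup>2) / 2 \<le> a} = 1 - ennreal (exp (- a * 1))"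
    using a by (simp add: ennreal_1[symmetric] ennreal_minus del: ennreal_1)
qed simp_all

lemma (in prob_space) std_normal_pair_of_char:
  assumes [measurable]: "X \<in> borel_measurable M" "Y \<in> borel_measurable M"
    and char: "\<And>a b. (\<integral>x. iexp (a * X x + b * Y x) \<partial>M) = of_real (exp (- (a\<^sup>2 + b\<^sup>2) / 2))"
  shows "distr M (borel \<Otimes>\<^sub>M borel) (\<lambda>x. (X x, Y x)) = std_normal_distribution \<Otimes>\<^sub>M std_normal_distribution"
proof (rule pair_measure_eqI[symmetric])
  let ?N = "std_normal_distribution" and ?P = "distr M (borel \<Otimes>\<^sub>M borel) (\<lambda>x. (X x, Y x))"
  interpret N: prob_space ?N by (rule prob_space_normal_density) simp
  interpret NN: pair_prob_space ?N ?N ..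
  interpret P: prob_space ?P by (rule prob_space_distr) measurable
  show "sigma_finite_measure ?N" ..
  then show "sigma_finite_measure ?N" .
  show sets: "sets (?N \<Otimes>\<^sub>M ?N) = sets ?P" by (simp cong: sets_pair_measure_cong)
  fix A B assume AB: "A \<in> sets ?N" "B \<in> sets ?N"
  \<comment> \<open>The plane is treated as a product indexed by \<open>bool\<close>, so that the
    criterion for finitely many coordinates applies to rectangles.\<close>
  let ?f = "\<lambda>i::bool. if i then fst else snd :: real \<times> real \<Rightarrow> real"
  have eq: "{z \<in> space ?P. \<forall>i\<in>UNIV. ?f i z \<in> (if i then A else B)} = A \<times> B"
    by (auto simp: space_pair_measure UNIV_bool)
  have "emeasure ?P {z \<in> space ?P. \<forall>i\<in>UNIV. ?f i z \<in> (if i then A else B)}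
      = emeasure (?N \<Otimes>\<^sub>M ?N) {z \<in> space ?P. \<forall>i\<in>UNIV. ?f i z \<in> (if i then A else B)}"
  proof (rule joint_char_measure)
    fix a :: "bool \<Rightarrow> real"
    have "(\<integral>z. iexp (\<Sum>i\<in>UNIV. a i * ?f i z) \<partial>?P) = of_real (exp (- ((a True)\<^sup>2 + (a False)\<^sup>2) / 2))"
      using char[of "a True" "a False"] by (subst integral_distr) (auto simp: UNIV_bool add.commute)
    also have "\<dots> = char ?N (a True) * char ?N (a False)"
      by (simp add: char_std_normal_distribution exp_add[symmetric] add_divide_distrib flip: of_real_mult)
    also have "\<dots> = (\<integral>x. \<integral>y. iexp (a True * x) * iexp (a False * y) \<partial>?N \<partial>?N)"
      by (simp add: char_def)
    also have "\<dots> = (\<integral>z. iexp (a True * fst z) * iexp (a False * snd z) \<partial>(?N \<Otimes>\<^sub>M ?N))"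
      by (subst NN.integral_fst'[symmetric]) (auto intro!: NN.integrable_const_bound[where B=1] simp: norm_mult)
    finally show "(\<integral>z. iexp (\<Sum>i\<in>UNIV. a i * ?f i z) \<partial>?P) = (\<integral>z. iexp (\<Sum>i\<in>UNIV. a i * ?f i z) \<partial>(?N \<Otimes>\<^sub>M ?N))"
      by (simp add: UNIV_bool exp_add[symmetric] algebra_simps)
  qed (use AB sets in \<open>auto intro: P.finite_measure_axioms NN.P.finite_measure_axioms\<close>)
  then have "emeasure ?P (A \<times> B) = emeasure (?N \<Otimes>\<^sub>M ?N) (A \<times> B)"
    unfolding eq .
  then show "emeasure ?N A * emeasure ?N B = emeasure ?P (A \<times> B)"
    using AB by (simp add: N.emeasure_pair_measure_Times)
qed

section \<open>Path integrals of a stationary Gaussian process\<close>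

lemma integrable_mult_pair:
  fixes f g :: "real \<Rightarrow> complex"
  assumes f: "integrable lborel f" and g: "integrable lborel g"
  shows "integrable (lborel \<Otimes>\<^sub>M lborel) (\<lambda>z. f (fst z) * g (snd z))"
    and "(\<integral>z. f (fst z) * g (snd z) \<partial>(lborel \<Otimes>\<^sub>M lborel)) = (\<integral>t. f t \<partial>lborel) * (\<integral>t. g t \<partial>lborel)"
proof -
  have [measurable]: "f \<in> borel_measurable borel" "g \<in> borel_measurable borel"
    using f g by auto
  show i: "integrable (lborel \<Otimes>\<^sub>M lborel) (\<lambda>z. f (fst z) * g (snd z))"
    using f g by (intro lborel_pair.Fubini_integrable) (auto simp: norm_mult)
  show "(\<integral>z. f (fst z) * g (snd z) \<partial>(lborel \<Otimes>\<^sub>M lborel)) = (\<integral>t. f t \<partial>lborel) * (\<integral>t. g t \<partial>lborel)"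
    by (subst lborel_pair.integral_fst'[OF i, symmetric]) simp
qed

lemma abs_mult_le: "\<bar>a * b\<bar> \<le> (a\<^sup>2 + b\<^sup>2) / 2" for a b :: real
  using sum_squares_bound[of "\<bar>a\<bar>" "\<bar>b\<bar>"] by (simp add: abs_mult)

lemma integrable_mult_of_squares:
  fixes f g :: "'b \<Rightarrow> real"
  assumes [measurable]: "f \<in> borel_measurable N" "g \<in> borel_measurable N"
    and f: "integrable N (\<lambda>x. (f x)\<^sup>2)" and g: "integrable N (\<lambda>x. (g x)\<^sup>2)"
  shows "integrable N (\<lambda>x. f x * g x)"
proof (rule Bochner_Integration.integrable_bound)
  show "integrable N (\<lambda>x. ((f x)\<^sup>2 + (g x)\<^sup>2) / 2)"
    using f g by simp
  show "AE x in N. norm (f x * g x) \<le> norm (((f x)\<^sup>2 + (g x)\<^sup>2) / 2)"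
    using abs_mult_le by (intro AE_I2) (metis abs_ge_self order.trans real_norm_def)
qed measurable

text \<open>\<open>Y\<close> plays the role of a jointly measurable modification. Stationarity is
  condensed to a constant mean and a correlation depending on the lag; the lag enters as
  \<open>u - t\<close> because \<open>fourier\<close> carries a negative exponent.\<close>

locale stationary_gaussian = prob_space M for M :: "'a measure" +
  fixes Y :: "real \<Rightarrow> 'a \<Rightarrow> real" and p :: "real \<Rightarrow> real" and m :: real
  assumes measurable_Y[measurable]: "(\<lambda>(t, x). Y t x) \<in> borel_measurable (borel \<Otimes>\<^sub>M M)"
    and gaussian_Y: "gaussian_process M Y"
    and integrable_p: "integrable lborel p" and p_pos: "\<And>\<nu>. 0 < p \<nu>"
    and mean_Y: "\<And>t. expectation (Y t) = m"
    and correlation_Y: "\<And>t u. complex_of_real (expectation (\<lambda>x. Y t x * Y u x))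
      = of_real (m\<^sup>2) + fourier (\<lambda>\<nu>. of_real (p \<nu>)) (u - t)"
begin

lemma Y_borel[measurable]: "Y t \<in> borel_measurable M"
  using gaussian_Y by (rule gaussian_process_measurable)

lemma Y_comp[measurable]:
  "f \<in> borel_measurable N \<Longrightarrow> h \<in> measurable N M \<Longrightarrow> (\<lambda>z. Y (f z) (h z)) \<in> borel_measurable N"
  using measurable_compose[OF _ measurable_Y, of "\<lambda>z. (f z, h z)" N] by simp

lemma Y_square: "integrable M (\<lambda>x. (Y t x)\<^sup>2)"
  by (rule gaussian_rv_square_integrable[OF gaussian_process_gaussian_rv[OF gaussian_Y]])

text \<open>The second moment at every time, by stationarity. It is the uniform bound behind the
  exchanges of path integrals and expectations.\<close>

definition power_Y :: real where "power_Y = expectation (\<lambda>x. (Y 0 x)\<^sup>2)"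

lemma Y_second_moment: "expectation (\<lambda>x. (Y t x)\<^sup>2) = power_Y"
proof -
  have "complex_of_real (expectation (\<lambda>x. Y t x * Y t x)) = of_real (expectation (\<lambda>x. Y 0 x * Y 0 x))"
    by (simp only: correlation_Y diff_self)
  then show ?thesis
    unfolding power_Y_def power2_eq_square of_real_eq_iff .
qed

lemma Y_prod: "integrable M (\<lambda>x. Y t x * Y u x)"
  by (rule integrable_mult_of_squares[OF Y_borel Y_borel Y_square Y_square])

lemma Y_prod_bound: "expectation (\<lambda>x. \<bar>Y t x * Y u x\<bar>) \<le> power_Y"
proof -
  have "expectation (\<lambda>x. \<bar>Y t x * Y u x\<bar>) \<le> expectation (\<lambda>x. ((Y t x)\<^sup>2 + (Y u x)\<^sup>2) / 2)"
    by (intro integral_mono abs_mult_le integrable_abs Y_prod integrable_divide Bochner_Integration.integrable_add Y_square)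
  also have "\<dots> = power_Y" by (simp add: Y_square Y_second_moment)
  finally show ?thesis .
qed

lemma Y_integrable: "integrable M (Y t)"
  by (rule square_integrable_imp_integrable[OF Y_borel Y_square])

lemma abs_expectation_le_sqrt:
  assumes [measurable]: "X \<in> borel_measurable M" and X2: "integrable M (\<lambda>x. (X x)\<^sup>2)"
  shows "expectation (\<lambda>x. \<bar>X x\<bar>) \<le> sqrt (expectation (\<lambda>x. (X x)\<^sup>2 :: real))"
proof -
  have i: "integrable M (\<lambda>x. \<bar>X x\<bar>)"
    using square_integrable_imp_integrable[OF assms] by simp
  have "0 \<le> variance (\<lambda>x. \<bar>X x\<bar>)" by simp
  also have "\<dots> = expectation (\<lambda>x. (X x)\<^sup>2) - (expectation (\<lambda>x. \<bar>X x\<bar>))\<^sup>2"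
    using i X2 by (subst variance_eq) auto
  finally show ?thesis by (intro real_le_rsqrt) simp
qed

lemma Y_abs_bound: "expectation (\<lambda>x. \<bar>Y t x\<bar>) \<le> sqrt power_Y"
  using abs_expectation_le_sqrt[OF Y_borel Y_square] by (simp add: Y_second_moment)

lemma Y_increment:
  "expectation (\<lambda>x. (Y u x - Y t x)\<^sup>2) = 2 * (power_Y - expectation (\<lambda>x. Y t x * Y u x))"
proof -
  have "(\<lambda>x. (Y u x - Y t x)\<^sup>2) = (\<lambda>x. (Y u x)\<^sup>2 + (Y t x)\<^sup>2 - 2 * (Y t x * Y u x))"
    by (auto simp: power2_eq_square algebra_simps)
  then show ?thesis using Y_square Y_prod by (simp add: Y_second_moment)
qed

text \<open>The mean square of an increment is twice the drop of the correlation below its value at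
  lag 0, and the correlation is continuous as the Fourier transform of an integrable function. The
  L1 distance is at most the root of that mean square.\<close>

lemma Y_L1_continuous:
  assumes q: "q \<longlonglongrightarrow> t"
  shows "(\<lambda>n. expectation (\<lambda>x. \<bar>Y (q n) x - Y t x\<bar>)) \<longlonglongrightarrow> 0"
proof -
  have "(\<lambda>n. of_real (m\<^sup>2) + fourier (\<lambda>\<nu>. of_real (p \<nu>)) (q n - t))
      \<longlonglongrightarrow> of_real (m\<^sup>2) + fourier (\<lambda>\<nu>. of_real (p \<nu>)) (t - t)"
    using integrable_p
    by (intro tendsto_intros isCont_tendsto_compose[OF isCont_fourier] q) auto
  then have "(\<lambda>n. complex_of_real (expectation (\<lambda>x. Y t x * Y (q n) x))) \<longlonglongrightarrow> of_real (expectation (\<lambda>x. Y t x * Y t x))"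
    by (simp only: correlation_Y)
  then have "(\<lambda>n. expectation (\<lambda>x. Y t x * Y (q n) x)) \<longlonglongrightarrow> power_Y"
    by (simp only: tendsto_of_real_iff Y_second_moment[of t, symmetric] power2_eq_square)
  then have "(\<lambda>n. sqrt (2 * (power_Y - expectation (\<lambda>x. Y t x * Y (q n) x)))) \<longlonglongrightarrow> sqrt (2 * (power_Y - power_Y))"
    by (intro tendsto_intros)
  then have lim: "(\<lambda>n. sqrt (2 * (power_Y - expectation (\<lambda>x. Y t x * Y (q n) x)))) \<longlonglongrightarrow> 0" by simp
  have "expectation (\<lambda>x. \<bar>Y (q n) x - Y t x\<bar>) \<le> sqrt (2 * (power_Y - expectation (\<lambda>x. Y t x * Y (q n) x)))" for n
    unfolding Y_increment[symmetric]
    by (intro abs_expectation_le_sqrt gaussian_process_increment_square_integrable[OF gaussian_Y]) auto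
  then show ?thesis
    by (intro tendsto_sandwich[OF _ _ tendsto_const lim]) auto
qed

text \<open>The pathwise integral against \<open>g\<close>, meaningful for almost every \<open>x\<close>.  The choice
  \<open>g = wavelet_kernel \<psi> t s\<close> gives the wavelet transform, so linear combinations of wavelet
  coefficients are again of this form.\<close>

definition lin :: "(real \<Rightarrow> complex) \<Rightarrow> 'a \<Rightarrow> complex" where
  "lin g x = (\<integral>\<tau>. of_real (Y \<tau> x) * g \<tau> \<partial>lborel)"

sublocale LM: pair_sigma_finite lborel M ..

text \<open>The reparametrisation \<open>q\<close> covers both the identity and the simple functions
  through which the time axis is sampled; the general field covers real and complex kernels.\<close>

lemma lin_integrable_pair:
  fixes g :: "real \<Rightarrow> 'b::{real_normed_field, banach, second_countable_topology}"
  assumes g: "integrable lborel g" and q[measurable]: "q \<in> borel_measurable borel"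
  shows "integrable (lborel \<Otimes>\<^sub>M M) (\<lambda>(\<tau>, x). of_real (Y (q \<tau>) x) * g \<tau>)"
proof (rule LM.Fubini_integrable)
  have [measurable]: "g \<in> borel_measurable borel" using g by simp
  show "(\<lambda>(\<tau>, x). of_real (Y (q \<tau>) x) * g \<tau>) \<in> borel_measurable (lborel \<Otimes>\<^sub>M M)"
    unfolding case_prod_beta' by measurable
  show "AE \<tau> in lborel. integrable M (\<lambda>x. case (\<tau>, x) of (\<tau>, x) \<Rightarrow> of_real (Y (q \<tau>) x) * g \<tau>)"
    using Y_integrable by (auto intro!: integrable_mult_left integrable_of_real)
  have "integrable lborel (\<lambda>\<tau>. expectation (\<lambda>x. \<bar>Y (q \<tau>) x\<bar>) * norm (g \<tau>))"
  proof (rule Bochner_Integration.integrable_bound)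
    show "integrable lborel (\<lambda>\<tau>. sqrt power_Y * norm (g \<tau>))" using g by auto
    have "norm (expectation (\<lambda>x. \<bar>Y (q \<tau>) x\<bar>) * norm (g \<tau>)) \<le> norm (sqrt power_Y * norm (g \<tau>))" for \<tau>
    proof -
      have "norm (expectation (\<lambda>x. \<bar>Y (q \<tau>) x\<bar>) * norm (g \<tau>)) = expectation (\<lambda>x. \<bar>Y (q \<tau>) x\<bar>) * norm (g \<tau>)"
        by simp
      also have "\<dots> \<le> sqrt power_Y * norm (g \<tau>)"
        by (intro mult_right_mono Y_abs_bound) simp
      finally show ?thesis by simp
    qed
    then show "AE \<tau> in lborel. norm (expectation (\<lambda>x. \<bar>Y (q \<tau>) x\<bar>) * norm (g \<tau>)) \<le> norm (sqrt power_Y * norm (g \<tau>))"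
      by simp
  qed measurable
  then show "integrable lborel (\<lambda>\<tau>. \<integral>x. norm (case (\<tau>, x) of (\<tau>, x) \<Rightarrow> of_real (Y (q \<tau>) x) * g \<tau>) \<partial>M)"
    by (simp add: norm_mult)
qed

lemma lin_AE_integrable:
  assumes g: "integrable lborel g"
  shows "AE x in M. integrable lborel (\<lambda>\<tau>. complex_of_real (Y \<tau> x) * g \<tau>)"
  using LM.AE_integrable_snd[OF lin_integrable_pair[OF g measurable_ident]] by simp

lemma lin_integrable: "integrable lborel g \<Longrightarrow> integrable M (lin g)"
  unfolding lin_def[abs_def] by (rule LM.integrable_snd) (simp add: lin_integrable_pair)

text \<open>Additivity is available only where all the path integrals exist, which for finitely many
  kernels is almost everywhere.\<close>

lemma lin_sum:
  assumes g: "\<And>i. i \<in> I \<Longrightarrow> integrable lborel (g i)" and I: "finite I"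
  shows "AE x in M. lin (\<lambda>\<tau>. \<Sum>i\<in>I. c i * g i \<tau>) x = (\<Sum>i\<in>I. c i * lin (g i) x)"
proof -
  have "AE x in M. \<forall>i\<in>I. integrable lborel (\<lambda>\<tau>. complex_of_real (Y \<tau> x) * g i \<tau>)"
    using lin_AE_integrable g I by (intro AE_finite_allI) auto
  then show ?thesis
  proof eventually_elim
    case (elim x)
    have "lin (\<lambda>\<tau>. \<Sum>i\<in>I. c i * g i \<tau>) x = (\<integral>\<tau>. (\<Sum>i\<in>I. c i * (of_real (Y \<tau> x) * g i \<tau>)) \<partial>lborel)"
      unfolding lin_def by (simp add: sum_distrib_left mult.left_commute)
    also have "\<dots> = (\<Sum>i\<in>I. \<integral>\<tau>. c i * (of_real (Y \<tau> x) * g i \<tau>) \<partial>lborel)"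
      using elim by (intro Bochner_Integration.integral_sum integrable_mult_right) auto
    finally show ?case by (simp add: lin_def)
  qed
qed

text \<open>Valid at every \<open>x\<close>: where the path integral does not exist, its default
  value 0 respects scaling.\<close>

lemma lin_cmult: "lin (\<lambda>\<tau>. c * g \<tau>) x = c * lin g x"
  unfolding lin_def by (simp add: mult.left_commute)

lemma lin_diff:
  assumes "integrable lborel g" "integrable lborel h"
  shows "AE x in M. lin (\<lambda>\<tau>. g \<tau> - h \<tau>) x = lin g x - lin h x"
  using lin_AE_integrable[OF assms(1)] lin_AE_integrable[OF assms(2)]
  by eventually_elim (simp add: lin_def right_diff_distrib)

lemma lin_cnj: "lin (\<lambda>\<tau>. cnj (g \<tau>)) x = cnj (lin g x)"
proof -
  have "lin (\<lambda>\<tau>. cnj (g \<tau>)) x = (\<integral>\<tau>. cnj (of_real (Y \<tau> x) * g \<tau>) \<partial>lborel)"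
    unfolding lin_def by simp
  then show ?thesis by (simp only: Bochner_Integration.integral_cnj lin_def)
qed

text \<open>Sampling the process along simple functions that converge to the identity of the time
  axis turns the integral into a finite combination of values of the process. Continuity in L1 makes
  the sampled integrals converge in L1, although single paths need not be continuous.\<close>

lemma gaussian_rv_integral:
  fixes h :: "real \<Rightarrow> real"
  assumes h: "integrable lborel h"
  shows "gaussian_rv M (\<lambda>x. \<integral>\<tau>. Y \<tau> x * h \<tau> \<partial>lborel)"
proof -
  have [measurable]: "h \<in> borel_measurable borel" using h by simp
  have pair: "integrable (lborel \<Otimes>\<^sub>M M) (\<lambda>(\<tau>, x). Y (r \<tau>) x * h \<tau>)" if "r \<in> borel_measurable borel" for r
    using lin_integrable_pair[OF h that] by simp
  obtain q where q: "\<And>n. simple_function borel (q n)" "\<And>\<tau>::real. (\<lambda>n. q n \<tau>) \<longlonglongrightarrow> \<tau>"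
    using borel_measurable_implies_sequence_metric[of "\<lambda>\<tau>::real. \<tau>" borel 0] by auto
  have qm[measurable]: "q n \<in> borel_measurable borel" for n
    using q(1) by (rule borel_measurable_simple_function)
  have fin: "finite (range (q n))" for n
    using q(1)[of n] by (simp add: simple_function_def)
  let ?X = "\<lambda>n x. \<integral>\<tau>. Y (q n \<tau>) x * h \<tau> \<partial>lborel"
  show ?thesis
  proof (rule gaussian_rv_L1_limit[of ?X])
    fix n
    \<comment> \<open>The weight of the sampled value \<open>Y r\<close> is the integral of
      \<open>h\<close> over the times that are sent to \<open>r\<close>.\<close>
    let ?a = "\<lambda>r. \<integral>\<tau>. indicator (q n -` {r}) \<tau> *\<^sub>R h \<tau> \<partial>lborel"
    have "?X n x = (\<Sum>r\<in>range (q n). ?a r * Y r x)" for x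
    proof -
      have "Y (q n \<tau>) x * h \<tau> = (\<Sum>r\<in>range (q n). Y r x * (indicator (q n -` {r}) \<tau> *\<^sub>R h \<tau>))" for \<tau>
        using fin[of n] by (subst sum.mono_neutral_right[where S="{q n \<tau>}"]) (auto simp: indicator_def)
      then have "?X n x = (\<integral>\<tau>. (\<Sum>r\<in>range (q n). Y r x * (indicator (q n -` {r}) \<tau> *\<^sub>R h \<tau>)) \<partial>lborel)"
        by simp
      also have "\<dots> = (\<Sum>r\<in>range (q n). \<integral>\<tau>. Y r x * (indicator (q n -` {r}) \<tau> *\<^sub>R h \<tau>) \<partial>lborel)"
        using measurable_sets[OF qm[of n], of "{_}"]
        by (intro Bochner_Integration.integral_sum integrable_mult_right integrable_mult_indicator h) simp
      finally show ?thesis by (simp add: mult.commute)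
    qed
    then show "gaussian_rv M (?X n)"
      using gaussian_Y fin unfolding gaussian_process_def by simp
  next
    show "integrable M (\<lambda>x. \<integral>\<tau>. Y \<tau> x * h \<tau> \<partial>lborel)"
      using pair[OF measurable_ident] by (intro LM.integrable_snd) simp
  next
    let ?D = "\<lambda>n \<tau> x. \<bar>Y (q n \<tau>) x * h \<tau> - Y \<tau> x * h \<tau>\<bar>"
    have D: "integrable (lborel \<Otimes>\<^sub>M M) (\<lambda>(\<tau>, x). ?D n \<tau> x)" for n
    proof -
      have "integrable (lborel \<Otimes>\<^sub>M M) (\<lambda>z. \<bar>(case z of (\<tau>, x) \<Rightarrow> Y (q n \<tau>) x * h \<tau>) - (case z of (\<tau>, x) \<Rightarrow> Y \<tau> x * h \<tau>)\<bar>)"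
        using pair[OF qm] pair[OF measurable_ident] by (intro integrable_abs Bochner_Integration.integrable_diff) auto
      then show ?thesis by (simp add: case_prod_beta')
    qed
    have D': "expectation (?D n \<tau>) = expectation (\<lambda>x. \<bar>Y (q n \<tau>) x - Y \<tau> x\<bar>) * \<bar>h \<tau>\<bar>" for n \<tau>
      by (simp add: left_diff_distrib[symmetric] abs_mult)
    \<comment> \<open>The error is estimated with the expectation inside: for each time it tends to
      0 by L1 continuity, and it is dominated by a multiple of |h|. Fubini then transfers the
      estimate to the path integrals.\<close>
    have "(\<lambda>n. \<integral>\<tau>. expectation (?D n \<tau>) \<partial>lborel) \<longlonglongrightarrow> (\<integral>\<tau>. 0 \<partial>(lborel :: real measure))"
    proof (rule integral_dominated_convergence[where w="\<lambda>\<tau>. 2 * sqrt power_Y * \<bar>h \<tau>\<bar>"])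
      show "AE \<tau> in lborel. (\<lambda>n. expectation (?D n \<tau>)) \<longlonglongrightarrow> 0"
        unfolding D' by (intro AE_I2 tendsto_mult_left_zero Y_L1_continuous q)
      fix n
      show "AE \<tau> in lborel. norm (expectation (?D n \<tau>)) \<le> 2 * sqrt power_Y * \<bar>h \<tau>\<bar>"
      proof (rule AE_I2)
        fix \<tau>
        have "expectation (\<lambda>x. \<bar>Y (q n \<tau>) x - Y \<tau> x\<bar>) \<le> expectation (\<lambda>x. \<bar>Y (q n \<tau>) x\<bar> + \<bar>Y \<tau> x\<bar>)"
          by (intro integral_mono integrable_abs Bochner_Integration.integrable_add Bochner_Integration.integrable_diff Y_integrable) auto
        also have "\<dots> \<le> 2 * sqrt power_Y"
          using Y_abs_bound[of "q n \<tau>"] Y_abs_bound[of \<tau>] by (simp add: Y_integrable)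
        finally show "norm (expectation (?D n \<tau>)) \<le> 2 * sqrt power_Y * \<bar>h \<tau>\<bar>"
          unfolding D' by (simp add: abs_mult mult_right_mono)
      qed
    qed (use h in \<open>auto intro!: borel_measurable_lebesgue_integral\<close>)
    then have lim: "(\<lambda>n. \<integral>\<tau>. expectation (?D n \<tau>) \<partial>lborel) \<longlonglongrightarrow> 0" by simp
    have "expectation (\<lambda>x. \<bar>?X n x - (\<integral>\<tau>. Y \<tau> x * h \<tau> \<partial>lborel)\<bar>) \<le> (\<integral>\<tau>. expectation (?D n \<tau>) \<partial>lborel)" for n
    proof -
      have "expectation (\<lambda>x. \<bar>?X n x - (\<integral>\<tau>. Y \<tau> x * h \<tau> \<partial>lborel)\<bar>) \<le> expectation (\<lambda>x. \<integral>\<tau>. ?D n \<tau> x \<partial>lborel)"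
      proof (rule integral_mono_AE)
        show "integrable M (\<lambda>x. \<bar>?X n x - (\<integral>\<tau>. Y \<tau> x * h \<tau> \<partial>lborel)\<bar>)"
          using LM.integrable_snd[OF pair[OF qm]] LM.integrable_snd[OF pair[OF measurable_ident]] by simp
        show "integrable M (\<lambda>x. \<integral>\<tau>. ?D n \<tau> x \<partial>lborel)" using D by (rule LM.integrable_snd)
        show "AE x in M. \<bar>?X n x - (\<integral>\<tau>. Y \<tau> x * h \<tau> \<partial>lborel)\<bar> \<le> (\<integral>\<tau>. ?D n \<tau> x \<partial>lborel)"
          using LM.AE_integrable_snd[OF pair[OF qm[of n]]] LM.AE_integrable_snd[OF pair[OF measurable_ident]]
        proof eventually_elim
          case (elim x)
          then have "?X n x - (\<integral>\<tau>. Y \<tau> x * h \<tau> \<partial>lborel) = (\<integral>\<tau>. Y (q n \<tau>) x * h \<tau> - Y \<tau> x * h \<tau> \<partial>lborel)"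
            by simp
          then show ?case
            using integral_abs_bound[of lborel "\<lambda>\<tau>. Y (q n \<tau>) x * h \<tau> - Y \<tau> x * h \<tau>"] by simp
        qed
      qed
      also have "\<dots> = (\<integral>\<tau>. expectation (?D n \<tau>) \<partial>lborel)"
        by (rule LM.Fubini_integral[OF D])
      finally show ?thesis .
    qed
    then show "(\<lambda>n. expectation (\<lambda>x. \<bar>?X n x - (\<integral>\<tau>. Y \<tau> x * h \<tau> \<partial>lborel)\<bar>)) \<longlonglongrightarrow> 0"
      by (intro tendsto_sandwich[OF _ _ tendsto_const lim]) auto
  qed
qed

lemma gaussian_rv_Re_lin:
  assumes g: "integrable lborel g"
  shows "gaussian_rv M (\<lambda>x. Re (lin g x))"
proof (rule gaussian_rv_cong_AE)
  show "gaussian_rv M (\<lambda>x. \<integral>\<tau>. Y \<tau> x * Re (g \<tau>) \<partial>lborel)"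
    using g by (intro gaussian_rv_integral) simp
  show "AE x in M. (\<integral>\<tau>. Y \<tau> x * Re (g \<tau>) \<partial>lborel) = Re (lin g x)"
    using lin_AE_integrable[OF g]
  proof eventually_elim
    case (elim x)
    have "Re (lin g x) = (\<integral>\<tau>. Re (of_real (Y \<tau> x) * g \<tau>) \<partial>lborel)"
      unfolding lin_def using elim by (rule integral_Re[symmetric])
    then show ?case by simp
  qed
  show "(\<lambda>x. Re (lin g x)) \<in> borel_measurable M"
    using lin_integrable[OF g] by measurable
qed

section \<open>First and second moments of path integrals\<close>

lemma expectation_lin:
  assumes g: "integrable lborel g"
  shows "expectation (lin g) = of_real m * fourier g 0"
proof -
  have "expectation (lin g) = (\<integral>\<tau>. expectation (\<lambda>x. complex_of_real (Y \<tau> x) * g \<tau>) \<partial>lborel)"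
    unfolding lin_def[abs_def] by (rule LM.Fubini_integral) (simp add: lin_integrable_pair[OF g])
  also have "\<dots> = (\<integral>\<tau>. of_real m * g \<tau> \<partial>lborel)"
    by (simp add: mean_Y)
  finally show ?thesis by (simp add: fourier_def)
qed

text \<open>The product is a double integral over two times. Exchanging with the expectation inserts
  the correlation, and exchanging with its spectral integral separates the two times. No conjugate
  is built in, so the same formula yields pseudo-covariances directly and covariances after
  conjugating one kernel.\<close>

lemma lin_prod:
  assumes g: "integrable lborel g" and h: "integrable lborel h"
  shows "integrable M (\<lambda>x. lin g x * lin h x)"
    and "expectation (\<lambda>x. lin g x * lin h x)
      = of_real (m\<^sup>2) * (fourier g 0 * fourier h 0) + (\<integral>\<nu>. of_real (p \<nu>) * (fourier g (- \<nu>) * fourier h \<nu>) \<partial>lborel)"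
proof -
  let ?L = "lborel \<Otimes>\<^sub>M lborel :: (real \<times> real) measure"
  interpret LL: pair_sigma_finite ?L M
    by (simp add: pair_sigma_finite_def lborel_prod sigma_finite_lborel sigma_finite_measure_axioms)
  interpret L3: pair_sigma_finite ?L "lborel :: real measure"
    by (simp add: pair_sigma_finite_def lborel_prod sigma_finite_lborel)
  have [measurable]: "g \<in> borel_measurable borel" "h \<in> borel_measurable borel" "p \<in> borel_measurable borel"
    using g h integrable_p by auto
  note gh = integrable_mult_pair[OF g h]
  let ?F = "\<lambda>z x. complex_of_real (Y (fst z) x * Y (snd z) x) * (g (fst z) * h (snd z))"
  \<comment> \<open>Absolute integrability: the expectation of |Y t Y u| is bounded uniformly in
    both times, and the product of the kernels is integrable on the plane.\<close>
  have F: "integrable (?L \<Otimes>\<^sub>M M) (\<lambda>(z, x). ?F z x)"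
  proof (rule LL.Fubini_integrable)
    show "(\<lambda>(z, x). ?F z x) \<in> borel_measurable (?L \<Otimes>\<^sub>M M)"
      unfolding case_prod_beta' by measurable
    show "AE z in ?L. integrable M (\<lambda>x. case (z, x) of (z, x) \<Rightarrow> ?F z x)"
      unfolding prod.case by (intro AE_I2 integrable_mult_left integrable_of_real Y_prod)
    have "integrable ?L (\<lambda>z. expectation (\<lambda>x. \<bar>Y (fst z) x * Y (snd z) x\<bar>) * norm (g (fst z) * h (snd z)))"
    proof (rule Bochner_Integration.integrable_bound)
      show "integrable ?L (\<lambda>z. power_Y * norm (g (fst z) * h (snd z)))"
        using gh(1) by (intro integrable_mult_right integrable_norm)
      have "norm (expectation (\<lambda>x. \<bar>Y t x * Y u x\<bar>) * norm w) \<le> norm (power_Y * norm w)" for t u and w :: complex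
      proof -
        have "norm (expectation (\<lambda>x. \<bar>Y t x * Y u x\<bar>) * norm w) = expectation (\<lambda>x. \<bar>Y t x * Y u x\<bar>) * norm w"
          by (simp add: abs_mult)
        also have "\<dots> \<le> power_Y * norm w" by (intro mult_right_mono Y_prod_bound) simp
        finally show ?thesis by simp
      qed
      then show "AE z in ?L. norm (expectation (\<lambda>x. \<bar>Y (fst z) x * Y (snd z) x\<bar>) * norm (g (fst z) * h (snd z)))
          \<le> norm (power_Y * norm (g (fst z) * h (snd z)))"
        by (intro AE_I2)
    qed measurable
    then show "integrable ?L (\<lambda>z. \<integral>x. norm (case (z, x) of (z, x) \<Rightarrow> ?F z x) \<partial>M)"
      unfolding prod.case norm_mult[of "complex_of_real _"] norm_of_real by simp
  qed
  have eq: "AE x in M. (\<integral>z. ?F z x \<partial>?L) = lin g x * lin h x"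
    using lin_AE_integrable[OF g] lin_AE_integrable[OF h]
  proof eventually_elim
    case (elim x)
    show ?case
      using integrable_mult_pair(2)[OF elim] unfolding lin_def by (simp add: mult_ac)
  qed
  have [measurable]: "lin g \<in> borel_measurable M" "lin h \<in> borel_measurable M"
    using lin_integrable g h by auto
  have iF: "integrable M (\<lambda>x. \<integral>z. ?F z x \<partial>?L)" using F by (rule LL.integrable_snd)
  show "integrable M (\<lambda>x. lin g x * lin h x)"
    using iF eq by (subst integrable_cong_AE[of _ _ "\<lambda>x. \<integral>z. ?F z x \<partial>?L"]) auto
  have "expectation (\<lambda>x. lin g x * lin h x) = expectation (\<lambda>x. \<integral>z. ?F z x \<partial>?L)"
    using iF eq by (intro integral_cong_AE) auto
  also have "\<dots> = (\<integral>z. expectation (?F z) \<partial>?L)"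
    by (rule LL.Fubini_integral[OF F])
  also have "\<dots> = (\<integral>z. of_real (m\<^sup>2) * (g (fst z) * h (snd z))
      + fourier (\<lambda>\<nu>. of_real (p \<nu>)) (snd z - fst z) * (g (fst z) * h (snd z)) \<partial>?L)"
  proof (intro Bochner_Integration.integral_cong refl)
    fix z
    have "expectation (?F z) = complex_of_real (expectation (\<lambda>x. Y (fst z) x * Y (snd z) x)) * (g (fst z) * h (snd z))"
      using Y_prod by (simp only: integral_mult_left_zero integral_of_real)
    then show "expectation (?F z) = of_real (m\<^sup>2) * (g (fst z) * h (snd z))
      + fourier (\<lambda>\<nu>. of_real (p \<nu>)) (snd z - fst z) * (g (fst z) * h (snd z))"
      by (simp only: correlation_Y distrib_right)
  qed
  also have "\<dots> = of_real (m\<^sup>2) * (fourier g 0 * fourier h 0)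
      + (\<integral>\<nu>. of_real (p \<nu>) * (fourier g (- \<nu>) * fourier h \<nu>) \<partial>lborel)"
  proof -
    let ?G = "\<lambda>z \<nu>. iexp (- (snd z - fst z) * \<nu>) * of_real (p \<nu>) * (g (fst z) * h (snd z))"
    have G: "integrable (?L \<Otimes>\<^sub>M lborel) (\<lambda>(z, \<nu>). ?G z \<nu>)"
    proof (rule L3.Fubini_integrable)
      show "(\<lambda>(z, \<nu>). ?G z \<nu>) \<in> borel_measurable (?L \<Otimes>\<^sub>M lborel)"
        unfolding case_prod_beta' by measurable
      show "AE z in ?L. integrable lborel (\<lambda>\<nu>. case (z, \<nu>) of (z, \<nu>) \<Rightarrow> ?G z \<nu>)"
        unfolding prod.case using integrable_p
        by (intro AE_I2 integrable_mult_left integrable_iexp_mult) simp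
      have "integrable ?L (\<lambda>z. (\<integral>\<nu>. \<bar>p \<nu>\<bar> \<partial>lborel) * norm (g (fst z) * h (snd z)))"
        using gh(1) by (intro integrable_mult_right integrable_norm)
      then show "integrable ?L (\<lambda>z. \<integral>\<nu>. norm (case (z, \<nu>) of (z, \<nu>) \<Rightarrow> ?G z \<nu>) \<partial>lborel)"
        by (simp add: norm_mult)
    qed
    have Gz: "(\<integral>\<nu>. ?G z \<nu> \<partial>lborel) = fourier (\<lambda>\<nu>. of_real (p \<nu>)) (snd z - fst z) * (g (fst z) * h (snd z))" for z
      unfolding fourier_iexp by (rule integral_mult_left_zero)
    have Gi: "(\<integral>z. ?G z \<nu> \<partial>?L) = of_real (p \<nu>) * (fourier g (- \<nu>) * fourier h \<nu>)" for \<nu>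
    proof -
      \<comment> \<open>The exponential in the lag factors into one exponential per time with
        opposite signs; hence \<open>g\<close> is evaluated at -\<nu> and \<open>h\<close> at
        \<nu>.\<close>
      have "?G z \<nu> = of_real (p \<nu>) * ((iexp (- (- \<nu>) * fst z) * g (fst z)) * (iexp (- \<nu> * snd z) * h (snd z)))" for z
        by (simp add: exp_add[symmetric] exp_diff exp_minus algebra_simps field_simps)
      then have "(\<integral>z. ?G z \<nu> \<partial>?L) = of_real (p \<nu>) * (\<integral>z. (iexp (- (- \<nu>) * fst z) * g (fst z)) * (iexp (- \<nu> * snd z) * h (snd z)) \<partial>?L)"
        by (simp only: integral_mult_right_zero)
      then show ?thesis
        unfolding fourier_iexp using integrable_mult_pair(2)[OF integrable_iexp_mult[OF g] integrable_iexp_mult[OF h]]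
        by (simp only:)
    qed
    have "(\<integral>z. fourier (\<lambda>\<nu>. of_real (p \<nu>)) (snd z - fst z) * (g (fst z) * h (snd z)) \<partial>?L)
        = (\<integral>z. \<integral>\<nu>. ?G z \<nu> \<partial>lborel \<partial>?L)"
      by (simp only: Gz)
    also have "\<dots> = (\<integral>\<nu>. \<integral>z. ?G z \<nu> \<partial>?L \<partial>lborel)"
      by (rule L3.Fubini_integral[OF G, symmetric])
    finally have I: "(\<integral>z. fourier (\<lambda>\<nu>. of_real (p \<nu>)) (snd z - fst z) * (g (fst z) * h (snd z)) \<partial>?L)
        = (\<integral>\<nu>. of_real (p \<nu>) * (fourier g (- \<nu>) * fourier h \<nu>) \<partial>lborel)"
      by (simp only: Gi)
    have "integrable ?L (\<lambda>z. fourier (\<lambda>\<nu>. of_real (p \<nu>)) (snd z - fst z) * (g (fst z) * h (snd z)))"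
      using L3.integrable_fst[OF G] by (simp only: Gz)
    moreover have "integrable ?L (\<lambda>z. complex_of_real (m\<^sup>2) * (g (fst z) * h (snd z)))"
      using gh(1) by (rule integrable_mult_right)
    moreover have "(\<integral>z. g (fst z) * h (snd z) \<partial>?L) = fourier g 0 * fourier h 0"
      using gh(2) by (simp add: fourier_def)
    ultimately show ?thesis
      by (simp only: Bochner_Integration.integral_add integral_mult_right_zero I)
  qed
  finally show "expectation (\<lambda>x. lin g x * lin h x)
      = of_real (m\<^sup>2) * (fourier g 0 * fourier h 0) + (\<integral>\<nu>. of_real (p \<nu>) * (fourier g (- \<nu>) * fourier h \<nu>) \<partial>lborel)" .
qed

end

section \<open>Kernels with one-sided spectrum\<close>

text \<open>The zero set is closed and its complement is an open null set, hence empty.\<close>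

lemma continuous_AE_lborel_eq_0:
  fixes f :: "real \<Rightarrow> 'b::{t2_space, zero}"
  assumes f: "\<And>x. isCont f x" and 0: "AE x in lborel. f x = 0"
  shows "f x = 0"
proof -
  have "closed (f -` {0})"
    using f by (intro continuous_closed_vimage) auto
  moreover have "AE x in lebesgue. x \<in> f -` {0}"
    using AE_completion[OF 0] by simp
  ultimately have "x \<in> f -` {0}" by (rule mem_closed_if_AE_lebesgue)
  then show ?thesis by simp
qed

lemma fourier_bound: "cmod (fourier f \<omega>) \<le> (\<integral>t. cmod (f t) \<partial>lborel)"
proof -
  have "cmod (fourier f \<omega>) \<le> (\<integral>t. cmod (iexp (- \<omega> * t) * f t) \<partial>lborel)"
    unfolding fourier_iexp by (rule integral_norm_bound)
  then show ?thesis by (simp add: norm_mult)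
qed

text \<open>The kernel of the wavelet transform is the complex conjugate of a rescaled wavelet, which moves
  the spectrum of an analytic wavelet from the positive to the negative frequencies.\<close>

definition anticausal_spectrum :: "(real \<Rightarrow> complex) \<Rightarrow> bool" where
  "anticausal_spectrum G \<longleftrightarrow> integrable lborel G \<and> (\<forall>\<omega>\<ge>0. fourier G \<omega> = 0)"

lemma anticausal_cmult: "anticausal_spectrum G \<Longrightarrow> anticausal_spectrum (\<lambda>\<tau>. c * G \<tau>)"
  by (auto simp: anticausal_spectrum_def fourier_cmult)

lemma anticausal_sum:
  "(\<And>i. i \<in> I \<Longrightarrow> anticausal_spectrum (G i)) \<Longrightarrow> anticausal_spectrum (\<lambda>\<tau>. \<Sum>i\<in>I. G i \<tau>)"
  by (auto simp: anticausal_spectrum_def fourier_sum)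

lemma anticausal_add:
  "anticausal_spectrum G \<Longrightarrow> anticausal_spectrum H \<Longrightarrow> anticausal_spectrum (\<lambda>\<tau>. G \<tau> + H \<tau>)"
  by (auto simp: anticausal_spectrum_def fourier_add)

lemma anticausal_diff:
  "anticausal_spectrum G \<Longrightarrow> anticausal_spectrum H \<Longrightarrow> anticausal_spectrum (\<lambda>\<tau>. G \<tau> - H \<tau>)"
  using anticausal_add[of G "\<lambda>\<tau>. -1 * H \<tau>"] anticausal_cmult[of H "-1"] by simp

section \<open>Path integrals against kernels with one-sided spectrum\<close>

context stationary_gaussian
begin

definition spectral_energy :: "(real \<Rightarrow> complex) \<Rightarrow> real" where
  "spectral_energy G = (\<integral>\<nu>. p \<nu> * (cmod (fourier G (- \<nu>)))\<^sup>2 \<partial>lborel)"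

lemma spectral_energy_cmult: "spectral_energy (\<lambda>\<tau>. c * G \<tau>) = (cmod c)\<^sup>2 * spectral_energy G"
  unfolding spectral_energy_def fourier_cmult norm_mult power_mult_distrib mult.left_commute[of _ "(cmod c)\<^sup>2"]
  by (rule integral_mult_right_zero)

text \<open>The spectral formula pairs the frequencies \<open>\<nu>\<close> and \<open>-\<nu>\<close>, of which only one lies in the spectra
  of \<open>G\<close> and \<open>H\<close>; this vanishing of the pseudo-covariance is the source of circular symmetry.\<close>

lemma lin_pseudo_covariance:
  assumes "anticausal_spectrum G" "anticausal_spectrum H"
  shows "expectation (\<lambda>x. lin G x * lin H x) = 0"
proof -
  have "fourier G (- \<nu>) * fourier H \<nu> = 0" for \<nu>
    using assms by (cases "0 \<le> \<nu>") (auto simp: anticausal_spectrum_def)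
  moreover have "integrable lborel G" "integrable lborel H" "fourier G 0 = 0"
    using assms by (auto simp: anticausal_spectrum_def)
  ultimately show ?thesis
    by (simp only: lin_prod(2)) simp
qed

lemma lin_mean: "anticausal_spectrum G \<Longrightarrow> expectation (lin G) = 0"
  by (simp add: anticausal_spectrum_def expectation_lin)

text \<open>The second moment formula for \<open>G\<close> and its conjugate. Conjugation reflects
  the frequency once more, so the two transforms meet at the same frequency and multiply to a
  squared modulus.\<close>

lemma lin_energy:
  assumes G: "anticausal_spectrum G"
  shows "integrable M (\<lambda>x. (cmod (lin G x))\<^sup>2)" "expectation (\<lambda>x. (cmod (lin G x))\<^sup>2) = spectral_energy G"
proof -
  have i: "integrable lborel G" "integrable lborel (\<lambda>\<tau>. cnj (G \<tau>))"
    using G by (auto simp: anticausal_spectrum_def)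
  have eq: "lin G x * lin (\<lambda>\<tau>. cnj (G \<tau>)) x = of_real ((cmod (lin G x))\<^sup>2)" for x
    by (simp only: lin_cnj complex_norm_square)
  have I: "integrable M (\<lambda>x. complex_of_real ((cmod (lin G x))\<^sup>2))"
    using lin_prod(1)[OF i] unfolding eq .
  then show "integrable M (\<lambda>x. (cmod (lin G x))\<^sup>2)"
    by (rule complex_of_real_integrable_eq[THEN iffD1])
  have "complex_of_real (expectation (\<lambda>x. (cmod (lin G x))\<^sup>2)) = expectation (\<lambda>x. lin G x * lin (\<lambda>\<tau>. cnj (G \<tau>)) x)"
    unfolding eq by (rule integral_complex_of_real[symmetric])
  also have "\<dots> = (\<integral>\<nu>. of_real (p \<nu> * (cmod (fourier G (- \<nu>)))\<^sup>2) \<partial>lborel)"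
  proof -
    have "fourier G 0 = 0" using G by (simp add: anticausal_spectrum_def)
    then show ?thesis
      by (simp only: lin_prod(2)[OF i] fourier_cnj complex_norm_square of_real_mult
          mult_zero_left mult_zero_right add_0_left)
  qed
  also have "\<dots> = of_real (spectral_energy G)"
    unfolding spectral_energy_def by (rule integral_complex_of_real)
  finally show "expectation (\<lambda>x. (cmod (lin G x))\<^sup>2) = spectral_energy G"
    by (simp only: of_real_eq_iff)
qed

lemma Re_lin_gaussian: "anticausal_spectrum G \<Longrightarrow> gaussian_rv M (\<lambda>x. Re (lin G x))"
  by (simp add: anticausal_spectrum_def gaussian_rv_Re_lin)

lemma Re_lin_mean:
  assumes G: "anticausal_spectrum G"
  shows "expectation (\<lambda>x. Re (lin G x)) = 0"
  using lin_mean[OF G] lin_integrable[of G] G by (simp add: anticausal_spectrum_def)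

text \<open>Multiplication by -i preserves the one-sided spectrum, so facts about real parts carry
  over to imaginary parts by rewriting with this identity.\<close>

lemma Im_lin: "Im (lin G x) = Re (lin (\<lambda>\<tau>. - \<i> * G \<tau>) x)"
  unfolding lin_cmult by simp

lemma Re_lin_prod_integrable:
  assumes "anticausal_spectrum G" "anticausal_spectrum H"
  shows "integrable M (\<lambda>x. Re (lin G x) * Re (lin H x))"
  using assms lin_integrable
  by (intro integrable_mult_of_squares gaussian_rv_square_integrable Re_lin_gaussian)
     (auto simp: anticausal_spectrum_def)

text \<open>Real and imaginary part of the vanishing pseudo-covariance: E[Re Re] - E[Im Im] = 0 and
  E[Re Im] + E[Im Re] = 0.\<close>

lemma lin_circular:
  assumes G: "anticausal_spectrum G" and H: "anticausal_spectrum H"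
  shows "expectation (\<lambda>x. Im (lin G x) * Im (lin H x)) = expectation (\<lambda>x. Re (lin G x) * Re (lin H x))"
    and "expectation (\<lambda>x. Im (lin G x) * Re (lin H x)) = - expectation (\<lambda>x. Re (lin G x) * Im (lin H x))"
proof -
  note [simp] = Re_lin_prod_integrable[OF G H] Re_lin_prod_integrable[OF anticausal_cmult[OF G, of "- \<i>"] H, folded Im_lin]
    Re_lin_prod_integrable[OF G anticausal_cmult[OF H, of "- \<i>"], folded Im_lin]
    Re_lin_prod_integrable[OF anticausal_cmult[OF G, of "- \<i>"] anticausal_cmult[OF H, of "- \<i>"], folded Im_lin]
  have i: "integrable M (\<lambda>x. lin G x * lin H x)"
    using G H by (intro lin_prod) (auto simp: anticausal_spectrum_def)
  have "expectation (\<lambda>x. Re (lin G x * lin H x)) = 0" "expectation (\<lambda>x. Im (lin G x * lin H x)) = 0"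
    using lin_pseudo_covariance[OF G H] integral_Re[OF i] integral_Im[OF i] by (simp_all only: zero_complex.sel)
  then show "expectation (\<lambda>x. Im (lin G x) * Im (lin H x)) = expectation (\<lambda>x. Re (lin G x) * Re (lin H x))"
    "expectation (\<lambda>x. Im (lin G x) * Re (lin H x)) = - expectation (\<lambda>x. Re (lin G x) * Im (lin H x))"
    by simp_all
qed

lemma Re_lin_second_moment:
  assumes G: "anticausal_spectrum G"
  shows "expectation (\<lambda>x. (Re (lin G x))\<^sup>2) = spectral_energy G / 2"
proof -
  have i: "integrable M (\<lambda>x. (Re (lin G x))\<^sup>2)" "integrable M (\<lambda>x. (Im (lin G x))\<^sup>2)"
    unfolding Im_lin by (intro gaussian_rv_square_integrable Re_lin_gaussian anticausal_cmult G)+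
  have "spectral_energy G = expectation (\<lambda>x. (Re (lin G x))\<^sup>2 + (Im (lin G x))\<^sup>2)"
    unfolding lin_energy(2)[OF G, symmetric] cmod_power2 ..
  also have "\<dots> = 2 * expectation (\<lambda>x. (Re (lin G x))\<^sup>2)"
    using lin_circular(1)[OF G G] i by (simp add: power2_eq_square)
  finally show ?thesis by simp
qed

text \<open>One factor 2 of the 4 arises because the real part carries half of the energy, the other
  from the Gaussian exponent - v / 2.\<close>

lemma Re_lin_char:
  assumes G: "anticausal_spectrum G"
  shows "expectation (\<lambda>x. iexp (Re (lin G x))) = of_real (exp (- spectral_energy G / 4))"
  using gaussian_rv_char[OF Re_lin_gaussian[OF G], of 1] Re_lin_mean[OF G] Re_lin_second_moment[OF G]
  by (simp add: exp_of_real[symmetric])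

lemma Re_lin_isserlis:
  assumes G: "anticausal_spectrum G" and H: "anticausal_spectrum H"
  shows "integrable M (\<lambda>x. (Re (lin G x))\<^sup>2 * (Re (lin H x))\<^sup>2)"
    and "expectation (\<lambda>x. (Re (lin G x))\<^sup>2 * (Re (lin H x))\<^sup>2)
      = spectral_energy G * spectral_energy H / 4 + 2 * (expectation (\<lambda>x. Re (lin G x) * Re (lin H x)))\<^sup>2"
proof -
  have i: "integrable lborel G" "integrable lborel H"
    using G H by (auto simp: anticausal_spectrum_def)
  have [measurable]: "lin G \<in> borel_measurable M" "lin H \<in> borel_measurable M"
    using lin_integrable i by auto
  have add: "gaussian_rv M (\<lambda>x. Re (lin G x) + Re (lin H x))"
  proof (rule gaussian_rv_cong_AE[OF Re_lin_gaussian[OF anticausal_add[OF G H]]])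
    show "AE x in M. Re (lin (\<lambda>\<tau>. G \<tau> + H \<tau>) x) = Re (lin G x) + Re (lin H x)"
      using lin_AE_integrable[OF i(1)] lin_AE_integrable[OF i(2)]
      by eventually_elim (simp add: lin_def distrib_left)
  qed measurable
  have diff: "gaussian_rv M (\<lambda>x. Re (lin G x) - Re (lin H x))"
  proof (rule gaussian_rv_cong_AE[OF Re_lin_gaussian[OF anticausal_diff[OF G H]]])
    show "AE x in M. Re (lin (\<lambda>\<tau>. G \<tau> - H \<tau>) x) = Re (lin G x) - Re (lin H x)"
      using lin_diff[OF i] by eventually_elim simp
  qed measurable
  note I = isserlis_square[OF Re_lin_gaussian[OF G] Re_lin_mean[OF G] Re_lin_gaussian[OF H] Re_lin_mean[OF H] add diff]
  show "integrable M (\<lambda>x. (Re (lin G x))\<^sup>2 * (Re (lin H x))\<^sup>2)" by (rule I(1))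
  show "expectation (\<lambda>x. (Re (lin G x))\<^sup>2 * (Re (lin H x))\<^sup>2)
      = spectral_energy G * spectral_energy H / 4 + 2 * (expectation (\<lambda>x. Re (lin G x) * Re (lin H x)))\<^sup>2"
    unfolding I(2) Re_lin_second_moment[OF G] Re_lin_second_moment[OF H] by simp
qed

text \<open>The product of the squared moduli splits into four products of squares. Each contributes
  a quarter of the product of the means, which cancels in the covariance, and twice a squared
  correlation; circularity makes these correlations agree in pairs up to sign, which turns the 2
  into 4.\<close>

lemma covariance_lin:
  assumes G: "anticausal_spectrum G" and H: "anticausal_spectrum H"
  shows "covariance M (\<lambda>x. (cmod (lin G x))\<^sup>2) (\<lambda>x. (cmod (lin H x))\<^sup>2)
    = 4 * (expectation (\<lambda>x. Re (lin G x) * Re (lin H x)))\<^sup>2 + 4 * (expectation (\<lambda>x. Re (lin G x) * Im (lin H x)))\<^sup>2"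
proof -
  let ?A = "\<lambda>x. (cmod (lin G x))\<^sup>2" and ?B = "\<lambda>x. (cmod (lin H x))\<^sup>2"
  have iG: "anticausal_spectrum (\<lambda>\<tau>. - \<i> * G \<tau>)" and iH: "anticausal_spectrum (\<lambda>\<tau>. - \<i> * H \<tau>)"
    by (rule anticausal_cmult, fact)+
  note RR = Re_lin_isserlis[OF G H] and RI = Re_lin_isserlis[OF G iH, folded Im_lin]
    and IR = Re_lin_isserlis[OF iG H, folded Im_lin] and II = Re_lin_isserlis[OF iG iH, folded Im_lin]
  have eG: "spectral_energy (\<lambda>\<tau>. - \<i> * G \<tau>) = spectral_energy G"
    and eH: "spectral_energy (\<lambda>\<tau>. - \<i> * H \<tau>) = spectral_energy H"
    by (simp_all only: spectral_energy_cmult norm_minus_cancel norm_ii power_one mult_1_left)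
  have AB: "(\<lambda>x. ?A x * ?B x) = (\<lambda>x. (Re (lin G x))\<^sup>2 * (Re (lin H x))\<^sup>2 + (Re (lin G x))\<^sup>2 * (Im (lin H x))\<^sup>2
      + (Im (lin G x))\<^sup>2 * (Re (lin H x))\<^sup>2 + (Im (lin G x))\<^sup>2 * (Im (lin H x))\<^sup>2)"
    by (auto simp: cmod_power2 algebra_simps)
  have iAB: "integrable M (\<lambda>x. ?A x * ?B x)"
    unfolding AB using RR(1) RI(1) IR(1) II(1) by simp
  have "covariance M ?A ?B = expectation (\<lambda>x. ?A x * ?B x - spectral_energy H * ?A x - spectral_energy G * ?B x + spectral_energy G * spectral_energy H)"
    unfolding covariance_def lin_energy(2)[OF G] lin_energy(2)[OF H]
    by (intro Bochner_Integration.integral_cong) (auto simp: algebra_simps)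
  also have "\<dots> = expectation (\<lambda>x. ?A x * ?B x) - spectral_energy G * spectral_energy H"
    using iAB lin_energy[OF G] lin_energy[OF H] by (simp add: prob_space)
  also have "expectation (\<lambda>x. ?A x * ?B x) = spectral_energy G * spectral_energy H
      + 4 * (expectation (\<lambda>x. Re (lin G x) * Re (lin H x)))\<^sup>2 + 4 * (expectation (\<lambda>x. Re (lin G x) * Im (lin H x)))\<^sup>2"
    unfolding AB
    by (simp only: Bochner_Integration.integral_add Bochner_Integration.integrable_add RR RI IR II
        eG eH lin_circular[OF G H] power2_minus)
  finally show ?thesis by simp
qed

text \<open>Strict positivity of \<open>p\<close> forces the transform to vanish almost everywhere,
  and its continuity removes the exceptional null set.\<close>

lemma spectral_energy_eq_0:
  assumes G: "integrable lborel G" and 0: "spectral_energy G = 0"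
  shows "fourier G \<omega> = 0"
proof -
  have cont: "isCont (\<lambda>\<nu>. fourier G (- \<nu>)) \<nu>" for \<nu>
    by (intro isCont_o2[OF _ isCont_fourier[OF G]] continuous_intros)
  then have "continuous_on UNIV (\<lambda>\<nu>. fourier G (- \<nu>))"
    by (simp add: continuous_at_imp_continuous_on)
  then have [measurable]: "(\<lambda>\<nu>. fourier G (- \<nu>)) \<in> borel_measurable borel"
    by (rule borel_measurable_continuous_onI)
  have [measurable]: "p \<in> borel_measurable borel" using integrable_p by simp
  have "integrable lborel (\<lambda>\<nu>. p \<nu> * (cmod (fourier G (- \<nu>)))\<^sup>2)"
  proof (rule Bochner_Integration.integrable_bound)
    show "integrable lborel (\<lambda>\<nu>. (\<integral>t. cmod (G t) \<partial>lborel)\<^sup>2 * p \<nu>)"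
      using integrable_p by simp
    have "norm (p \<nu> * (cmod (fourier G (- \<nu>)))\<^sup>2) \<le> norm ((\<integral>t. cmod (G t) \<partial>lborel)\<^sup>2 * p \<nu>)" for \<nu>
      using power_mono[OF fourier_bound[of G "- \<nu>"] norm_ge_zero, of 2] p_pos[of \<nu>]
      by (simp add: abs_mult mult.commute)
    then show "AE \<nu> in lborel. norm (p \<nu> * (cmod (fourier G (- \<nu>)))\<^sup>2) \<le> norm ((\<integral>t. cmod (G t) \<partial>lborel)\<^sup>2 * p \<nu>)"
      by simp
  qed measurable
  then have "AE \<nu> in lborel. p \<nu> * (cmod (fourier G (- \<nu>)))\<^sup>2 = 0"
    using 0 p_pos unfolding spectral_energy_def
    by (subst (asm) integral_nonneg_eq_0_iff_AE) (auto simp: less_imp_le)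
  then have "AE \<nu> in lborel. fourier G (- \<nu>) = 0"
    by eventually_elim (use p_pos in \<open>auto simp: less_le\<close>)
  from continuous_AE_lborel_eq_0[OF cont this, of "- \<omega>"] show ?thesis by simp
qed

lemma spectral_energy_nonneg: "0 \<le> spectral_energy G"
  unfolding spectral_energy_def by (intro integral_nonneg_AE AE_I2) (simp add: p_pos less_imp_le)

text \<open>Each component has half of the energy as its variance, \<open>\<sigma>\<close> squared.
  After division by \<open>\<sigma>\<close> the components form a standard normal pair, and the
  quotient is half of their sum of squares.\<close>

lemma exponential_lin:
  assumes Z[measurable]: "Z \<in> borel_measurable M" and ZG: "AE x in M. Z x = lin G x"
    and G: "anticausal_spectrum G" and pos: "spectral_energy G \<noteq> 0"
  shows "distributed M lborel (\<lambda>x. (cmod (Z x))\<^sup>2 / spectral_energy G) (exponential_density 1)"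
proof -
  define \<sigma> where "\<sigma> = sqrt (spectral_energy G / 2)"
  have \<sigma>: "\<sigma> > 0" "spectral_energy G = 2 * \<sigma>\<^sup>2"
    using pos spectral_energy_nonneg[of G] by (auto simp: \<sigma>_def)
  have "distr M (borel \<Otimes>\<^sub>M borel) (\<lambda>x. (Re (Z x) / \<sigma>, Im (Z x) / \<sigma>)) = std_normal_distribution \<Otimes>\<^sub>M std_normal_distribution"
  proof (rule std_normal_pair_of_char)
    fix a b
    \<comment> \<open>The coefficient with Re (c z) = (a Re z + b Im z) / \<sigma>. Its kernel has
      energy 2 (a^2 + b^2), which gives the exponent of a standard normal pair.\<close>
    let ?c = "Complex (a / \<sigma>) (- b / \<sigma>)"
    have [measurable]: "lin G \<in> borel_measurable M"
      using lin_integrable G by (auto simp: anticausal_spectrum_def)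
    have "expectation (\<lambda>x. iexp (a * (Re (Z x) / \<sigma>) + b * (Im (Z x) / \<sigma>))) = expectation (\<lambda>x. iexp (Re (lin (\<lambda>\<tau>. ?c * G \<tau>) x)))"
      using ZG by (intro integral_cong_AE) (auto simp: lin_cmult)
    also have "\<dots> = of_real (exp (- spectral_energy (\<lambda>\<tau>. ?c * G \<tau>) / 4))"
      by (rule Re_lin_char[OF anticausal_cmult[OF G]])
    also have "- spectral_energy (\<lambda>\<tau>. ?c * G \<tau>) / 4 = - (a\<^sup>2 + b\<^sup>2) / 2"
      unfolding spectral_energy_cmult \<sigma>(2) using \<sigma>(1) by (simp add: cmod_power2 power_divide field_simps)
    finally show "expectation (\<lambda>x. iexp (a * (Re (Z x) / \<sigma>) + b * (Im (Z x) / \<sigma>))) = of_real (exp (- (a\<^sup>2 + b\<^sup>2) / 2))"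
      by simp
  qed measurable
  then have "distributed M lborel (\<lambda>x. ((Re (Z x) / \<sigma>)\<^sup>2 + (Im (Z x) / \<sigma>)\<^sup>2) / 2) (exponential_density 1)"
    by (intro exponential_of_std_normal_pair) auto
  also have "(\<lambda>x. ((Re (Z x) / \<sigma>)\<^sup>2 + (Im (Z x) / \<sigma>)\<^sup>2) / 2) = (\<lambda>x. (cmod (Z x))\<^sup>2 / spectral_energy G)"
    using \<sigma> by (auto simp: cmod_power2 power_divide add_divide_distrib)
  finally show ?thesis .
qed

end

section \<open>The wavelet kernel\<close>

definition wavelet_kernel :: "(real \<Rightarrow> complex) \<Rightarrow> real \<Rightarrow> real \<Rightarrow> real \<Rightarrow> complex" where
  "wavelet_kernel \<psi> t s \<tau> = 1 / of_real s * cnj (\<psi> ((\<tau> - t) / s))"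

lemma integrable_wavelet_kernel:
  "integrable lborel \<psi> \<Longrightarrow> 0 < s \<Longrightarrow> integrable lborel (wavelet_kernel \<psi> t s)"
  unfolding wavelet_kernel_def[abs_def] by (intro integrable_affine[of "\<lambda>t. cnj (\<psi> t)"]) auto

lemma fourier_wavelet_kernel:
  "0 < s \<Longrightarrow> fourier (wavelet_kernel \<psi> t s) \<omega> = iexp (- \<omega> * t) * cnj (fourier \<psi> (- (s * \<omega>)))"
  unfolding wavelet_kernel_def[abs_def]
  using fourier_affine[of s "\<lambda>t. cnj (\<psi> t)" t \<omega>] by (simp only: fourier_cnj)

lemma anticausal_wavelet_kernel:
  assumes \<psi>: "analytic_mother_wavelet \<psi>" and s: "0 < s"
  shows "anticausal_spectrum (wavelet_kernel \<psi> t s)"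
  unfolding anticausal_spectrum_def
proof (intro conjI allI impI)
  show "integrable lborel (wavelet_kernel \<psi> t s)"
    using \<psi> s by (intro integrable_wavelet_kernel) (auto simp: analytic_mother_wavelet_def)
  fix \<omega> :: real assume "0 \<le> \<omega>"
  then have "- (s * \<omega>) \<le> 0" using s by simp
  then have "fourier \<psi> (- (s * \<omega>)) = 0"
    using \<psi> unfolding analytic_mother_wavelet_def by blast
  then show "fourier (wavelet_kernel \<psi> t s) \<omega> = 0"
    by (simp add: fourier_wavelet_kernel[OF s])
qed

lemma eq_0_of_scale_invariant:
  fixes f :: "real \<Rightarrow> 'b::{t2_space, zero}"
  assumes cont: "isCont f 0" and 0: "f 0 = 0" and s: "0 < s1" "0 < s2" "s1 \<noteq> s2"
    and eq: "\<And>\<omega>. f (s1 * \<omega>) = f (s2 * \<omega>)"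
  shows "f \<omega> = 0"
proof -
  \<comment> \<open>The smaller scale over the larger: a ratio below 1, so that iteration drives
    every argument to 0.\<close>
  define r where "r = min s1 s2 / max s1 s2"
  have r: "0 < r" "r < 1" using s by (auto simp: r_def min_def max_def)
  have step: "f (r * \<omega>) = f \<omega>" for \<omega>
    using eq[of "\<omega> / s1"] eq[of "\<omega> / s2"] s by (auto simp: r_def min_def max_def)
  have "f (r ^ n * \<omega>) = f \<omega>" for n
  proof (induction n)
    case (Suc n)
    then show ?case using step[of "r ^ n * \<omega>"] by (simp add: mult.assoc)
  qed simp
  moreover have "(\<lambda>n. f (r ^ n * \<omega>)) \<longlonglongrightarrow> f 0"
    using r by (intro isCont_tendsto_compose[OF cont] tendsto_mult_left_zero LIMSEQ_power_zero) auto
  ultimately have "(\<lambda>n. f \<omega>) \<longlonglongrightarrow> f 0" by simp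
  then show ?thesis using 0 by (simp add: LIMSEQ_const_iff)
qed

section \<open>From the stationary process to its measurable modification\<close>

lemma (in prob_space) stationary_expectation_pair:
  fixes g :: "real \<times> real \<Rightarrow> real"
  assumes stat: "stationary_process M \<Phi>" and [measurable]: "\<And>t. \<Phi> t \<in> borel_measurable M"
    and [measurable]: "g \<in> borel_measurable (borel \<Otimes>\<^sub>M borel)"
  shows "expectation (\<lambda>x. g (\<Phi> t x, \<Phi> u x)) = expectation (\<lambda>x. g (\<Phi> (t - u) x, \<Phi> 0 x))"
proof -
  let ?F = "{t - u, 0}"
  let ?P = "\<Pi>\<^sub>M t\<in>?F. (borel :: real measure)"
  let ?g = "\<lambda>\<phi>::real \<Rightarrow> real. g (\<phi> (t - u), \<phi> 0)"
  have g: "?g \<in> borel_measurable ?P"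
    by (rule measurable_compose[OF measurable_Pair assms(3)]) (auto intro: measurable_component_singleton)
  have r: "(\<lambda>x. \<lambda>v\<in>?F. \<Phi> (v + h) x) \<in> measurable M ?P" for h
    by (intro measurable_restrict) simp
  have eq: "distr M ?P (\<lambda>x. \<lambda>v\<in>?F. \<Phi> (v + u) x) = distr M ?P (\<lambda>x. \<lambda>v\<in>?F. \<Phi> v x)"
    using stat[unfolded stationary_process_def, rule_format, of ?F u] by blast
  have "expectation (\<lambda>x. g (\<Phi> t x, \<Phi> u x)) = expectation (\<lambda>x. ?g (\<lambda>v\<in>?F. \<Phi> (v + u) x))"
    by simp
  also have "\<dots> = (\<integral>\<phi>. ?g \<phi> \<partial>distr M ?P (\<lambda>x. \<lambda>v\<in>?F. \<Phi> (v + u) x))"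
    by (rule integral_distr[OF r g, symmetric])
  also have "\<dots> = (\<integral>\<phi>. ?g \<phi> \<partial>distr M ?P (\<lambda>x. \<lambda>v\<in>?F. \<Phi> v x))"
    by (simp only: eq)
  also have "\<dots> = expectation (\<lambda>x. ?g (\<lambda>v\<in>?F. \<Phi> v x))"
    using integral_distr[OF r[of 0] g] by simp
  finally show ?thesis by simp
qed

text \<open>Linear combinations and products involve finitely many times, so almost sure equality at
  each time transfers them from \<Phi> to the modification. The correlation is the squared mean plus
  the covariance at lag t - u, to which the spectral density applies.\<close>

lemma (in prob_space) stationary_gaussian_modification:
  assumes gauss: "gaussian_process M \<Phi>" and stat: "stationary_process M \<Phi>"
    and spec: "spectral_density M \<Phi> p" and mod: "measurable_modification M \<Phi> Y"
  shows "stationary_gaussian M Y p (expectation (\<Phi> 0))"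
proof -
  define m where "m = expectation (\<Phi> 0)"
  have \<Phi>[measurable]: "\<Phi> t \<in> borel_measurable M" for t
    using gauss by (rule gaussian_process_measurable)
  have Y: "(\<lambda>(t, x). Y t x) \<in> borel_measurable (borel \<Otimes>\<^sub>M M)" and AE: "AE x in M. Y t x = \<Phi> t x" for t
    using mod by (auto simp: measurable_modification_def)
  have [measurable]: "Y t \<in> borel_measurable M" for t
    using measurable_Pair2[OF Y, of t] by simp
  \<comment> \<open>The pair of times 0 and t is shifted back by t; the second component then
    compares time t with time 0.\<close>
  have mean: "expectation (\<Phi> t) = m" for t
    using stationary_expectation_pair[OF stat \<Phi>, of snd 0 t]
    by (simp add: m_def)
  have sq: "integrable M (\<lambda>x. (\<Phi> t x)\<^sup>2)" for t
    by (rule gaussian_rv_square_integrable[OF gaussian_process_gaussian_rv[OF gauss]])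
  have int: "integrable M (\<Phi> t)" for t
    by (rule square_integrable_imp_integrable[OF \<Phi> sq])
  have prod: "integrable M (\<lambda>x. \<Phi> t x * \<Phi> u x)" for t u
    by (rule integrable_mult_of_squares[OF \<Phi> \<Phi> sq sq])
  show ?thesis
    unfolding m_def[symmetric]
  proof
    show "(\<lambda>(t, x). Y t x) \<in> borel_measurable (borel \<Otimes>\<^sub>M M)" by (rule Y)
    show "integrable lborel p" "\<And>\<nu>. 0 < p \<nu>"
      using spec by (auto simp: spectral_density_def)
    show "gaussian_process M Y"
      unfolding gaussian_process_def
    proof (intro allI impI)
      fix F :: "real set" and a assume F: "finite F"
      have "AE x in M. \<forall>t\<in>F. Y t x = \<Phi> t x"
        using F AE by (intro AE_finite_allI) auto
      then have "AE x in M. (\<Sum>t\<in>F. a t * \<Phi> t x) = (\<Sum>t\<in>F. a t * Y t x)"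
        by eventually_elim (auto intro: sum.cong)
      then show "gaussian_rv M (\<lambda>x. \<Sum>t\<in>F. a t * Y t x)"
        by (rule gaussian_rv_cong_AE[OF gauss[unfolded gaussian_process_def, rule_format, OF F]]) measurable
    qed
    fix t u
    have "expectation (Y t) = expectation (\<Phi> t)"
      using AE[of t] by (intro integral_cong_AE) auto
    then show "expectation (Y t) = m" by (simp add: mean)
    have "expectation (\<lambda>x. Y t x * Y u x) = expectation (\<lambda>x. \<Phi> t x * \<Phi> u x)"
      using AE[of t] AE[of u] by (intro integral_cong_AE) auto
    also have "\<dots> = m\<^sup>2 + expectation (\<lambda>x. (\<Phi> t x - m) * (\<Phi> u x - m))"
    proof -
      have "(\<lambda>x. (\<Phi> t x - m) * (\<Phi> u x - m)) = (\<lambda>x. \<Phi> t x * \<Phi> u x - m * \<Phi> t x - m * \<Phi> u x + m\<^sup>2)"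
        by (auto simp: power2_eq_square algebra_simps)
      then show ?thesis
        using prod[of t u] int mean[of t] mean[of u] by (simp add: prob_space power2_eq_square)
    qed
    also have "expectation (\<lambda>x. (\<Phi> t x - m) * (\<Phi> u x - m)) = covariance M (\<Phi> (t - u)) (\<Phi> 0)"
      using stationary_expectation_pair[OF stat \<Phi>, of "\<lambda>z. (fst z - m) * (snd z - m)" t u]
      by (simp add: covariance_def mean)
    finally have "complex_of_real (expectation (\<lambda>x. Y t x * Y u x))
        = of_real (m\<^sup>2) + complex_of_real (covariance M (\<Phi> (t - u)) (\<Phi> 0))"
      by simp
    also have "complex_of_real (covariance M (\<Phi> (t - u)) (\<Phi> 0))
        = (\<integral>\<nu>. iexp ((t - u) * \<nu>) * of_real (p \<nu>) \<partial>lborel)"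
      using spec by (simp only: spectral_density_def)
    also have "\<dots> = fourier (\<lambda>\<nu>. of_real (p \<nu>)) (u - t)"
      by (simp only: fourier_iexp minus_diff_eq)
    finally show "complex_of_real (expectation (\<lambda>x. Y t x * Y u x))
        = of_real (m\<^sup>2) + fourier (\<lambda>\<nu>. of_real (p \<nu>)) (u - t)" .
  qed
qed

section \<open>Circular symmetry, exponential law and scalogram covariance of the wavelet
  transform\<close>

theorem proposition1:
  fixes M :: "'a measure"
    and \<Phi> :: "real \<Rightarrow> 'a \<Rightarrow> real"
    and p :: "real \<Rightarrow> real"
    and \<psi> :: "real \<Rightarrow> complex"
    and W :: "real \<Rightarrow> real \<Rightarrow> 'a \<Rightarrow> complex"
  assumes "prob_space M"
    and "gaussian_process M \<Phi>"
    and "stationary_process M \<Phi>"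
    and "mean_square_continuous M \<Phi>"
    and "spectral_density M \<Phi> p"
    and "analytic_mother_wavelet \<psi>"
    and "wavelet_transform_of M \<psi> \<Phi> W"
  shows "(\<forall>t (d::nat) s. (\<forall>i\<in>{1..d}. 0 < s i) \<longrightarrow>
            complex_gaussian_vector M {1..d} (\<lambda>i. W t (s i)) \<and>
            circularly_symmetric M {1..d} (\<lambda>i. W t (s i)))
       \<and> (\<forall>t s1 s2. 0 < s1 \<longrightarrow> 0 < s2 \<longrightarrow> s1 \<noteq> s2 \<longrightarrow>
            distributed M lborel
              (\<lambda>x. (cmod (W t s1 x - W t s2 x))\<^sup>2 / (wavelet_dist M W s1 s2)\<^sup>2)
              (exponential_density 1))
       \<and> (\<forall>t s1 s2. 0 < s1 \<longrightarrow> 0 < s2 \<longrightarrow>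
            covariance M (scalogram W t s1) (scalogram W t s2)
              = 4 * (\<integral>x. Re (W t s1 x) * Re (W t s2 x) \<partial>M)\<^sup>2
              + 4 * (\<integral>x. Re (W t s1 x) * Im (W t s2 x) \<partial>M)\<^sup>2)
       \<and> (\<forall>t s. 0 < s \<longrightarrow>
            prob_space.variance M (scalogram W t s)
              = 4 * (\<integral>x. \<bar>Re (W t s x)\<bar>\<^sup>2 \<partial>M)\<^sup>2
          \<and> 4 * (\<integral>x. \<bar>Re (W t s x)\<bar>\<^sup>2 \<partial>M)\<^sup>2
              = (\<integral>x. scalogram W t s x \<partial>M)\<^sup>2)"
proof -
  interpret prob_space M by fact
  obtain \<Phi>' where mod: "measurable_modification M \<Phi> \<Phi>'"
    and Wm: "\<And>t s. 0 < s \<Longrightarrow> W t s \<in> borel_measurable M"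
    and W\<Phi>: "\<And>t s. 0 < s \<Longrightarrow> AE x in M. W t s x = path_wavelet_transform \<psi> (\<lambda>\<tau>. \<Phi>' \<tau> x) t s"
    using assms(7) unfolding wavelet_transform_of_def by blast
  interpret S: stationary_gaussian M \<Phi>' p "expectation (\<Phi> 0)"
    by (rule stationary_gaussian_modification[OF assms(2,3,5) mod])
  let ?K = "wavelet_kernel \<psi>"
  have \<psi>: "integrable lborel \<psi>" "\<not> (AE t in lborel. \<psi> t = 0)" "fourier \<psi> 0 = 0"
    using assms(6) by (auto simp: analytic_mother_wavelet_def)
  have K: "anticausal_spectrum (?K t s)" if "0 < s" for t s
    using assms(6) that by (rule anticausal_wavelet_kernel)
  have Ki: "integrable lborel (?K t s)" if "0 < s" for t s
    using \<psi>(1) that by (rule integrable_wavelet_kernel)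
  \<comment> \<open>The bridge from W to kernels: laws and expectations ignore null sets, so the
    claims can be proved for \<open>S.lin\<close>.\<close>
  have WK: "AE x in M. W t s x = S.lin (?K t s) x" if "0 < s" for t s
    using W\<Phi>[OF that] by (simp add: path_wavelet_transform_def S.lin_def wavelet_kernel_def mult.assoc)
  have lin_m[measurable]: "S.lin (?K t s) \<in> borel_measurable M" if "0 < s" for t s
    using S.lin_integrable[OF Ki[OF that]] by simp

  have a: "complex_gaussian_vector M {1..d} (\<lambda>i. W t (s i)) \<and> circularly_symmetric M {1..d} (\<lambda>i. W t (s i))"
    if s: "\<forall>i\<in>{1..d}. 0 < s i" for t and d :: nat and s
  proof
    let ?G = "\<lambda>c \<tau>. \<Sum>i\<in>{1..d}. c i * ?K t (s i) \<tau>"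
    have G: "anticausal_spectrum (?G c)" for c
      using s by (intro anticausal_sum anticausal_cmult K) auto
    have WG: "AE x in M. (\<Sum>i\<in>{1..d}. c i * W t (s i) x) = S.lin (?G c) x" for c
    proof -
      have "AE x in M. \<forall>i\<in>{1..d}. W t (s i) x = S.lin (?K t (s i)) x"
        using s WK by (intro AE_finite_allI) auto
      moreover have "AE x in M. S.lin (?G c) x = (\<Sum>i\<in>{1..d}. c i * S.lin (?K t (s i)) x)"
        using s Ki by (intro S.lin_sum) auto
      ultimately show ?thesis by eventually_elim simp
    qed
    have Wm': "i \<in> {1..d} \<Longrightarrow> W t (s i) \<in> borel_measurable M" for i
      using s Wm by auto
    have lin_G: "S.lin (?G c) \<in> borel_measurable M" for c
      using S.lin_integrable[of "?G c"] G[of c] by (auto simp: anticausal_spectrum_def)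
    show "complex_gaussian_vector M {1..d} (\<lambda>i. W t (s i))"
      unfolding complex_gaussian_vector_def
    proof (intro allI)
      fix a b :: "nat \<Rightarrow> real"
      \<comment> \<open>Re ((a - ib) w) = a Re w + b Im w, so the real combination is the real part
        of one path integral.\<close>
      let ?c = "\<lambda>i. Complex (a i) (- b i)"
      show "gaussian_rv M (\<lambda>x. \<Sum>i\<in>{1..d}. a i * Re (W t (s i) x) + b i * Im (W t (s i) x))"
      proof (rule gaussian_rv_cong_AE[OF S.Re_lin_gaussian[OF G[of ?c]]])
        show "AE x in M. Re (S.lin (?G ?c) x) = (\<Sum>i\<in>{1..d}. a i * Re (W t (s i) x) + b i * Im (W t (s i) x))"
          using WG[of ?c] by eventually_elim (drule sym, simp)
        show "(\<lambda>x. \<Sum>i\<in>{1..d}. a i * Re (W t (s i) x) + b i * Im (W t (s i) x)) \<in> borel_measurable M"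
        proof (rule borel_measurable_sum)
          fix i assume "i \<in> {1..d}"
          note [measurable] = Wm'[OF this]
          show "(\<lambda>x. a i * Re (W t (s i) x) + b i * Im (W t (s i) x)) \<in> borel_measurable M"
            by measurable
        qed
      qed
    qed
    show "circularly_symmetric M {1..d} (\<lambda>i. W t (s i))"
      unfolding circularly_symmetric_def
    proof (intro allI distr_complex_vector_eqI_char)
      fix \<theta> :: real and c :: "nat \<Rightarrow> complex"
      let ?e = "exp (\<i> * of_real \<theta>)"
      have W_sum: "(\<lambda>x. \<Sum>i\<in>{1..d}. c i * W t (s i) x) \<in> borel_measurable M"
        using Wm' by (intro borel_measurable_sum borel_measurable_times) auto
      \<comment> \<open>Used with z the rotation and with z = 1; in the former case the rotation
        moves into the kernel, where it leaves the energy unchanged.\<close>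
      have cong: "expectation (\<lambda>x. iexp (Re (z * (\<Sum>i\<in>{1..d}. c i * W t (s i) x))))
          = expectation (\<lambda>x. iexp (Re (z * S.lin (?G c) x)))" for z
      proof (rule integral_cong_AE)
        show "(\<lambda>x. iexp (Re (z * (\<Sum>i\<in>{1..d}. c i * W t (s i) x)))) \<in> borel_measurable M"
          using W_sum by measurable
        show "(\<lambda>x. iexp (Re (z * S.lin (?G c) x))) \<in> borel_measurable M"
          using lin_G[of c] by measurable
        show "AE x in M. iexp (Re (z * (\<Sum>i\<in>{1..d}. c i * W t (s i) x))) = iexp (Re (z * S.lin (?G c) x))"
          using WG[of c] by eventually_elim (simp only:)
      qed
      have "expectation (\<lambda>x. iexp (Re (\<Sum>i\<in>{1..d}. c i * (?e * W t (s i) x))))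
          = expectation (\<lambda>x. iexp (Re (?e * (\<Sum>i\<in>{1..d}. c i * W t (s i) x))))"
        by (simp only: sum_distrib_left mult.left_commute)
      also have "\<dots> = expectation (\<lambda>x. iexp (Re (S.lin (\<lambda>\<tau>. ?e * ?G c \<tau>) x)))"
        unfolding S.lin_cmult by (rule cong)
      also have "\<dots> = of_real (exp (- S.spectral_energy (?G c) / 4))"
        unfolding S.Re_lin_char[OF anticausal_cmult[OF G]] S.spectral_energy_cmult by simp
      also have "\<dots> = expectation (\<lambda>x. iexp (Re (S.lin (?G c) x)))"
        by (rule S.Re_lin_char[OF G, symmetric])
      also have "\<dots> = expectation (\<lambda>x. iexp (Re (\<Sum>i\<in>{1..d}. c i * W t (s i) x)))"
        using cong[of 1] by (simp only: mult_1_left)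
      finally show "expectation (\<lambda>x. iexp (Re (\<Sum>i\<in>{1..d}. c i * (?e * W t (s i) x))))
          = expectation (\<lambda>x. iexp (Re (\<Sum>i\<in>{1..d}. c i * W t (s i) x)))" .
    qed (use Wm' in auto)
  qed

  have b: "distributed M lborel (\<lambda>x. (cmod (W t s1 x - W t s2 x))\<^sup>2 / (wavelet_dist M W s1 s2)\<^sup>2) (exponential_density 1)"
    if s: "0 < s1" "0 < s2" "s1 \<noteq> s2" for t s1 s2
  proof -
    let ?G = "\<lambda>t \<tau>. ?K t s1 \<tau> - ?K t s2 \<tau>"
    have G: "anticausal_spectrum (?G t)" for t
      using s by (intro anticausal_diff K)
    have fG: "fourier (?G t) \<omega> = iexp (- \<omega> * t) * cnj (fourier \<psi> (- (s1 * \<omega>)) - fourier \<psi> (- (s2 * \<omega>)))" for t \<omega>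
      unfolding fourier_diff[OF Ki[OF s(1)] Ki[OF s(2)]] fourier_wavelet_kernel[OF s(1)] fourier_wavelet_kernel[OF s(2)]
      by (simp only: complex_cnj_diff right_diff_distrib)
    \<comment> \<open>Time enters the transform only through a phase. This allows
      \<open>wavelet_dist\<close>, evaluated at time 0, to normalise the increment at any time
      t.\<close>
    have energy: "S.spectral_energy (?G t) = S.spectral_energy (?G 0)"
      unfolding S.spectral_energy_def fG norm_mult by simp
    have WG: "AE x in M. W t s1 x - W t s2 x = S.lin (?G t) x" for t
      using WK[OF s(1), of t] WK[OF s(2), of t] S.lin_diff[OF Ki[OF s(1), of t] Ki[OF s(2), of t]]
      by eventually_elim simp
    have [measurable]: "W t s1 \<in> borel_measurable M" "W t s2 \<in> borel_measurable M" for t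
      using Wm s by auto
    have lin_G[measurable]: "S.lin (?G t) \<in> borel_measurable M" for t
      using S.lin_integrable[of "?G t"] G[of t] by (auto simp: anticausal_spectrum_def)
    have "(wavelet_dist M W s1 s2)\<^sup>2 = expectation (\<lambda>x. (cmod (W 0 s1 x - W 0 s2 x))\<^sup>2)"
      unfolding wavelet_dist_def by simp
    also have "\<dots> = expectation (\<lambda>x. (cmod (S.lin (?G 0) x))\<^sup>2)"
      using WG[of 0] by (intro integral_cong_AE) auto
    finally have dist: "(wavelet_dist M W s1 s2)\<^sup>2 = S.spectral_energy (?G t)"
      unfolding S.lin_energy(2)[OF G] energy .
    have "S.spectral_energy (?G t) \<noteq> 0"
    proof
      assume 0: "S.spectral_energy (?G t) = 0"
      \<comment> \<open>Zero energy annihilates the transform of the difference kernel; its phase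
        factor never vanishes and can be cancelled.\<close>
      have "fourier \<psi> (s1 * \<omega>) = fourier \<psi> (s2 * \<omega>)" for \<omega>
        using S.spectral_energy_eq_0[OF _ 0, of "- \<omega>"] G[of t] unfolding fG by (simp add: anticausal_spectrum_def)
      then have "fourier \<psi> \<omega> = 0" for \<omega>
        by (rule eq_0_of_scale_invariant[OF isCont_fourier[OF \<psi>(1)] \<psi>(3) s])
      then show False using fourier_eq_0[OF \<psi>(1)] \<psi>(2) by blast
    qed
    then show ?thesis
      unfolding dist by (intro S.exponential_lin[OF _ WG G]) measurable
  qed

  have scal: "AE x in M. scalogram W t s x = (cmod (S.lin (?K t s) x))\<^sup>2" if "0 < s" for t s
    using WK[OF that, of t] by eventually_elim (simp add: scalogram_def)
  have scal_m[measurable]: "scalogram W t s \<in> borel_measurable M" if "0 < s" for t s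
    using Wm[OF that, of t] unfolding scalogram_def[abs_def] by measurable
  have scal_mean: "expectation (scalogram W t s) = expectation (\<lambda>x. (cmod (S.lin (?K t s) x))\<^sup>2)" if "0 < s" for t s
    using scal[OF that, of t] that by (intro integral_cong_AE) auto

  have c: "covariance M (scalogram W t s1) (scalogram W t s2)
      = 4 * (expectation (\<lambda>x. Re (W t s1 x) * Re (W t s2 x)))\<^sup>2 + 4 * (expectation (\<lambda>x. Re (W t s1 x) * Im (W t s2 x)))\<^sup>2"
    if s: "0 < s1" "0 < s2" for t s1 s2
  proof -
    note [measurable] = Wm[OF s(1), of t] Wm[OF s(2), of t] scal_m[OF s(1)] scal_m[OF s(2)] lin_m[OF s(1)] lin_m[OF s(2)]
    have "covariance M (scalogram W t s1) (scalogram W t s2)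
        = covariance M (\<lambda>x. (cmod (S.lin (?K t s1) x))\<^sup>2) (\<lambda>x. (cmod (S.lin (?K t s2) x))\<^sup>2)"
      unfolding covariance_def scal_mean[OF s(1)] scal_mean[OF s(2)]
      using scal[OF s(1), of t] scal[OF s(2), of t] by (intro integral_cong_AE) auto
    also have "\<dots> = 4 * (expectation (\<lambda>x. Re (S.lin (?K t s1) x) * Re (S.lin (?K t s2) x)))\<^sup>2
        + 4 * (expectation (\<lambda>x. Re (S.lin (?K t s1) x) * Im (S.lin (?K t s2) x)))\<^sup>2"
      using K[OF s(1)] K[OF s(2)] by (rule S.covariance_lin)
    also have "expectation (\<lambda>x. Re (S.lin (?K t s1) x) * Re (S.lin (?K t s2) x)) = expectation (\<lambda>x. Re (W t s1 x) * Re (W t s2 x))"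
      using WK[OF s(1), of t] WK[OF s(2), of t] by (intro integral_cong_AE) auto
    also have "expectation (\<lambda>x. Re (S.lin (?K t s1) x) * Im (S.lin (?K t s2) x)) = expectation (\<lambda>x. Re (W t s1 x) * Im (W t s2 x))"
      using WK[OF s(1), of t] WK[OF s(2), of t] by (intro integral_cong_AE) auto
    finally show ?thesis .
  qed

  have d: "variance (scalogram W t s) = 4 * (expectation (\<lambda>x. \<bar>Re (W t s x)\<bar>\<^sup>2))\<^sup>2
      \<and> 4 * (expectation (\<lambda>x. \<bar>Re (W t s x)\<bar>\<^sup>2))\<^sup>2 = (expectation (scalogram W t s))\<^sup>2"
    if s: "0 < s" for t s
  proof -
    note [measurable] = Wm[OF s] lin_m[OF s]
    \<comment> \<open>For equal kernels the antisymmetric circularity relation equates this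
      expectation with its own negative, so the second square in the covariance formula
      disappears.\<close>
    have "expectation (\<lambda>x. Re (W t s x) * Im (W t s x)) = expectation (\<lambda>x. Re (S.lin (?K t s) x) * Im (S.lin (?K t s) x))"
      using WK[OF s, of t] by (intro integral_cong_AE) auto
    also have "\<dots> = 0"
      using S.lin_circular(2)[OF K[OF s, of t] K[OF s, of t]] unfolding mult.commute[of "Im _"] by linarith
    finally have RI: "expectation (\<lambda>x. Re (W t s x) * Im (W t s x)) = 0" .
    have "expectation (\<lambda>x. \<bar>Re (W t s x)\<bar>\<^sup>2) = expectation (\<lambda>x. (Re (S.lin (?K t s) x))\<^sup>2)"
      using WK[OF s, of t] by (intro integral_cong_AE) auto
    also have "\<dots> = S.spectral_energy (?K t s) / 2"
      by (rule S.Re_lin_second_moment[OF K[OF s]])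
    finally have R: "expectation (\<lambda>x. \<bar>Re (W t s x)\<bar>\<^sup>2) = S.spectral_energy (?K t s) / 2" .
    have "variance (scalogram W t s) = covariance M (scalogram W t s) (scalogram W t s)"
      by (simp add: covariance_def power2_eq_square)
    also have "\<dots> = 4 * (expectation (\<lambda>x. \<bar>Re (W t s x)\<bar>\<^sup>2))\<^sup>2"
      unfolding c[OF s s] RI by (simp add: power2_eq_square)
    finally show ?thesis
      unfolding R scal_mean[OF s] S.lin_energy(2)[OF K[OF s]] by (simp add: power_divide)
  qed
  show ?thesis
    by (intro conjI allI impI; (rule a[THEN conjunct1] a[THEN conjunct2] b c d[THEN conjunct1] d[THEN conjunct2]); assumption)
qed

end
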